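(* Let $X_0,X_1,X_2,\ldots$ be i.i.d. real random variables with $\mathbb{E} X_0=0$ and $0<\mathbb{E} X_0^2<\infty$, and let $T_n$ be the associated random Toeplitz matrices. Then $$\lim_{n\to\infty}\frac{\|T_n\|}{\mathbb{E}\|T_n\|}=1\quad\text{almost surely.}$$
   Context: For a sequence of real random variables $X_0,X_1,\ldots$, the random symmetric Toeplitz matrix is $T_n=[X_{|i-j|}]_{1\le i,j\le n}$ and $\|T_n\|$ denotes its operator norm on $\ell_2^n$. *)

theory Defs
  imports "HOL-Probability.Probability"
begin

definition mat_opnorm :: "nat \<Rightarrow> (nat \<Rightarrow> nat \<Rightarrow> real) \<Rightarrow> real" where
  "mat_opnorm n A =
     Sup {sqrt (\<Sum>i<n. (\<Sum>j<n. A i j * x j)\<^sup>2) | x :: nat \<Rightarrow> real. (\<Sum>j<n. (x j)\<^sup>2) \<le> 1}"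

definition toeplitz :: "(nat \<Rightarrow> real) \<Rightarrow> nat \<Rightarrow> nat \<Rightarrow> real" where
  "toeplitz a i j = a (if i \<le> j then j - i else i - j)"

definition toeplitz_norm :: "nat \<Rightarrow> (nat \<Rightarrow> real) \<Rightarrow> real" where
  "toeplitz_norm n a = mat_opnorm n (toeplitz a)"

end

theory Submission
  imports Defs "HOL-Real_Asymp.Real_Asymp"
begin

text \<open>
  Write \<open>e n\<close> for the expected norm. The norm is nondecreasing in \<open>n\<close> and changes by at most
  \<open>2 \<bar>x - y\<bar>\<close> when one variable is changed from \<open>x\<close> to \<open>y\<close>, so after truncating the variables at
  \<open>sqrt n\<close> a martingale argument bounds its fourth central moment by \<open>O(n\<^sup>2)\<close>. Together with the
  lower bound \<open>e n \<ge> c sqrt (n ln n)\<close> this makes a relative deviation \<open>\<epsilon>\<close> of probability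
  \<open>O(1 / (ln n)\<^sup>2)\<close>, which is summable along geometrically growing indices; a finite second moment
  suffices for the truncation to be eventually without effect. Choosing the indices as the times at which
  \<open>e\<close> crosses powers of \<open>1 + \<epsilon>\<close>, monotonicity controls all other \<open>n\<close>.

  For the lower bound, condition on the signs of the variables and test against trigonometric vectors
  at the discrete Fourier frequencies. The resulting linear forms in bounded independent variables are
  exactly uncorrelated, and the second moment method applied to the sum of their exponentials shows
  that their maximum is of order \<open>sqrt (n ln n)\<close>.
\<close>

section \<open>Norms of Toeplitz matrices\<close>

text \<open>The fourth moment is used because the variance falls just short: for fluctuations of
  order sqrt n against a mean of order sqrt (n ln n), Chebyshev's inequality gives 1 / ln n, which
  along n = \<rho>^k is the divergent series of 1 / k, whereas the fourth power gives 1 / k^2. The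
  logarithm in the lower bound is essential here: a bound of order sqrt n would give no decay at
  all. The truncation level sqrt n balances two demands. Fourth moments of the truncated variables
  are at most n times the second moment, so that n of them still sum to O(n^2); and the bias caused
  by truncation is O(sqrt n), negligible against sqrt (n ln n). The obstacle in the lower bound is
  that the variables need not have exponential moments. Replacing a variable by its conditional
  expectation given its sign can only decrease the expected maximum, by convexity, and produces
  bounded variables to which the second moment method applies.\<close>

lemma (in prob_space) integrable_bounded:
  fixes f :: "'a \<Rightarrow> real"
  assumes "f \<in> borel_measurable M" "\<And>x. x \<in> space M \<Longrightarrow> \<bar>f x\<bar> \<le> B"
  shows "integrable M f"
  using assms by (intro integrable_const_bound[of _ B]) auto

lemma (in prob_space) abs_integral_le:
  fixes f g :: "'a \<Rightarrow> real"
  assumes "integrable M g" "\<And>x. x \<in> space M \<Longrightarrow> \<bar>f x\<bar> \<le> g x"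
  shows "\<bar>\<integral>x. f x \<partial>M\<bar> \<le> (\<integral>x. g x \<partial>M)"
proof (cases "integrable M f")
  case True
  have "\<bar>\<integral>x. f x \<partial>M\<bar> \<le> (\<integral>x. \<bar>f x\<bar> \<partial>M)" by (rule integral_abs_bound)
  also have "\<dots> \<le> (\<integral>x. g x \<partial>M)" using True assms by (intro integral_mono) auto
  finally show ?thesis .
next
  case False
  \<comment> \<open>Without integrability the integral of \<open>f\<close> is 0 by convention, so
    only the sign of the right-hand side matters.\<close>
  have "0 \<le> (\<integral>x. g x \<partial>M)"
    using assms(2) by (intro integral_nonneg_AE) (auto intro!: AE_I2 order_trans[OF abs_ge_zero])
  with False show ?thesis by (simp add: not_integrable_integral_eq)
qed

text \<open>A row meets each value \<open>a k\<close> at most twice, once on either side of the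
  diagonal.\<close>

lemma toeplitz_row_sum_le:
  assumes "i < n"
  shows "(\<Sum>j<n. \<bar>toeplitz a i j\<bar>) \<le> 2 * (\<Sum>k<n. \<bar>a k\<bar>)"
proof -
  have "(\<Sum>j<n. \<bar>toeplitz a i j\<bar>) = (\<Sum>j\<in>{..i}. \<bar>toeplitz a i j\<bar>) + (\<Sum>j\<in>{i<..<n}. \<bar>toeplitz a i j\<bar>)"
    using assms by (subst sum.union_disjoint[symmetric]) (auto intro!: sum.cong)
  also have "(\<Sum>j\<in>{..i}. \<bar>toeplitz a i j\<bar>) = (\<Sum>k\<in>(\<lambda>j. i - j) ` {..i}. \<bar>a k\<bar>)"
    by (subst sum.reindex) (auto simp: inj_on_def toeplitz_def intro!: sum.cong)
  also have "\<dots> \<le> (\<Sum>k<n. \<bar>a k\<bar>)"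
    using assms by (intro sum_mono2) auto
  also have "(\<Sum>j\<in>{i<..<n}. \<bar>toeplitz a i j\<bar>) = (\<Sum>k\<in>(\<lambda>j. j - i) ` {i<..<n}. \<bar>a k\<bar>)"
    by (subst sum.reindex) (auto simp: inj_on_def toeplitz_def intro!: sum.cong)
  also have "\<dots> \<le> (\<Sum>k<n. \<bar>a k\<bar>)"
    using assms by (intro sum_mono2) auto
  finally show ?thesis by simp
qed

lemma toeplitz_commute: "toeplitz a i j = toeplitz a j i"
  by (auto simp: toeplitz_def)

lemma toeplitz_diff: "toeplitz (\<lambda>k. a k - b k) i j = toeplitz a i j - toeplitz b i j"
  by (simp add: toeplitz_def)

text \<open>Schur test: by symmetry the bound on absolute row sums is also one on column sums, and
  together they bound the operator norm.\<close>

lemma toeplitz_mult_le: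
  "L2_set (\<lambda>i. \<Sum>j<n. toeplitz a i j * x j) {..<n} \<le> 2 * (\<Sum>k<n. \<bar>a k\<bar>) * L2_set x {..<n}"
proof -
  define R where "R = 2 * (\<Sum>k<n. \<bar>a k\<bar>)"
  have R: "R \<ge> 0" unfolding R_def by (simp add: sum_nonneg)
  have "(\<Sum>i<n. (\<Sum>j<n. toeplitz a i j * x j)\<^sup>2) \<le> (\<Sum>i<n. R * (\<Sum>j<n. \<bar>toeplitz a i j\<bar> * (x j)\<^sup>2))"
  proof (rule sum_mono)
    fix i assume i: "i \<in> {..<n}"
    have "(\<Sum>j<n. toeplitz a i j * x j)\<^sup>2 \<le> (\<Sum>j<n. \<bar>toeplitz a i j\<bar> * \<bar>x j\<bar>)\<^sup>2"
      by (rule power2_le_iff_abs_le[THEN iffD2])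
         (auto intro!: sum_nonneg order_trans[OF sum_abs] simp: abs_mult)
    \<comment> \<open>Splitting each weight into two square roots lets Cauchy-Schwarz leave one row
      sum and one weighted sum of squares.\<close>
    also have "\<dots> = (\<Sum>j<n. sqrt \<bar>toeplitz a i j\<bar> * (sqrt \<bar>toeplitz a i j\<bar> * \<bar>x j\<bar>))\<^sup>2"
      by (simp add: mult.assoc[symmetric])
    also have "\<dots> \<le> (\<Sum>j<n. (sqrt \<bar>toeplitz a i j\<bar>)\<^sup>2) * (\<Sum>j<n. (sqrt \<bar>toeplitz a i j\<bar> * \<bar>x j\<bar>)\<^sup>2)"
      by (rule Cauchy_Schwarz_ineq_sum)
    also have "\<dots> = (\<Sum>j<n. \<bar>toeplitz a i j\<bar>) * (\<Sum>j<n. \<bar>toeplitz a i j\<bar> * (x j)\<^sup>2)"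
      by (simp add: power_mult_distrib)
    also have "\<dots> \<le> R * (\<Sum>j<n. \<bar>toeplitz a i j\<bar> * (x j)\<^sup>2)"
      using i toeplitz_row_sum_le[of i n a] by (intro mult_right_mono) (auto simp: R_def intro!: sum_nonneg)
    finally show "(\<Sum>j<n. toeplitz a i j * x j)\<^sup>2 \<le> R * (\<Sum>j<n. \<bar>toeplitz a i j\<bar> * (x j)\<^sup>2)" .
  qed
  also have "\<dots> = R * (\<Sum>j<n. \<Sum>i<n. \<bar>toeplitz a i j\<bar> * (x j)\<^sup>2)"
    by (subst sum.swap) (simp add: sum_distrib_left)
  also have "\<dots> = R * (\<Sum>j<n. (\<Sum>i<n. \<bar>toeplitz a j i\<bar>) * (x j)\<^sup>2)"
    by (simp add: sum_distrib_right toeplitz_commute)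
  also have "\<dots> \<le> R * (\<Sum>j<n. R * (x j)\<^sup>2)"
    using R toeplitz_row_sum_le[of _ n a]
    by (intro mult_left_mono sum_mono mult_right_mono) (auto simp: R_def)
  also have "\<dots> = R\<^sup>2 * (\<Sum>j<n. (x j)\<^sup>2)"
    by (simp add: sum_distrib_left power2_eq_square mult.assoc)
  finally have "sqrt (\<Sum>i<n. (\<Sum>j<n. toeplitz a i j * x j)\<^sup>2) \<le> sqrt (R\<^sup>2 * (\<Sum>j<n. (x j)\<^sup>2))"
    by simp
  then show ?thesis using R by (simp add: L2_set_def real_sqrt_mult R_def)
qed

section \<open>The norm as a supremum and its dependence on the sequence and the size\<close>

lemma toeplitz_norm_eq:
  "toeplitz_norm n a = Sup {L2_set (\<lambda>i. \<Sum>j<n. toeplitz a i j * x j) {..<n} | x. (\<Sum>j<n. (x j)\<^sup>2) \<le> 1}"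
  by (simp add: toeplitz_norm_def mat_opnorm_def L2_set_def)

lemma toeplitz_norm_ge:
  assumes "(\<Sum>j<n. (x j)\<^sup>2) \<le> 1"
  shows "L2_set (\<lambda>i. \<Sum>j<n. toeplitz a i j * x j) {..<n} \<le> toeplitz_norm n a"
proof -
  \<comment> \<open>\<open>Sup\<close> on the reals is only meaningful for sets bounded above; the
    Schur test supplies the bound.\<close>
  have "bdd_above {L2_set (\<lambda>i. \<Sum>j<n. toeplitz a i j * x j) {..<n} | x. (\<Sum>j<n. (x j)\<^sup>2) \<le> 1}"
  proof (rule bdd_aboveI, clarify)
    fix x :: "nat \<Rightarrow> real" assume "(\<Sum>j<n. (x j)\<^sup>2) \<le> 1"
    then have "L2_set x {..<n} \<le> 1" by (simp add: L2_set_def)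
    then show "L2_set (\<lambda>i. \<Sum>j<n. toeplitz a i j * x j) {..<n} \<le> 2 * (\<Sum>k<n. \<bar>a k\<bar>)"
      by (intro order_trans[OF toeplitz_mult_le] mult_left_le) (auto simp: sum_nonneg)
  qed
  then show ?thesis
    unfolding toeplitz_norm_eq using assms by (intro cSup_upper) auto
qed

lemma toeplitz_norm_le:
  assumes "\<And>x. (\<Sum>j<n. (x j)\<^sup>2) \<le> 1 \<Longrightarrow> L2_set (\<lambda>i. \<Sum>j<n. toeplitz a i j * x j) {..<n} \<le> c"
  shows "toeplitz_norm n a \<le> c"
  unfolding toeplitz_norm_eq
proof (rule cSup_least)
  show "{L2_set (\<lambda>i. \<Sum>j<n. toeplitz a i j * x j) {..<n} | x. (\<Sum>j<n. (x j)\<^sup>2) \<le> 1} \<noteq> {}"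
    by (auto intro!: exI[of _ "\<lambda>_. 0"])
qed (use assms in auto)

lemma toeplitz_norm_nonneg: "toeplitz_norm n a \<ge> 0"
  using toeplitz_norm_ge[where n = n and x = "\<lambda>_. 0" and a = a] by (simp add: L2_set_def)

lemma L2_set_toeplitz_le_norm:
  "L2_set (\<lambda>i. \<Sum>j<n. toeplitz a i j * x j) {..<n} \<le> toeplitz_norm n a * L2_set x {..<n}"
proof (cases "L2_set x {..<n} = 0")
  case True
  then show ?thesis using toeplitz_mult_le[where n = n and a = a and x = x] by simp
next
  case False
  define r where "r = L2_set x {..<n}"
  have r: "r > 0" using False by (simp add: r_def less_le)
  have "(\<Sum>j<n. (x j / r)\<^sup>2) = (\<Sum>j<n. (x j)\<^sup>2) / r\<^sup>2"
    by (simp add: power_divide sum_divide_distrib)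
  also have "\<dots> = 1"
    using r by (simp add: r_def L2_set_def sum_nonneg)
  finally have "L2_set (\<lambda>i. \<Sum>j<n. toeplitz a i j * (x j / r)) {..<n} \<le> toeplitz_norm n a"
    by (intro toeplitz_norm_ge) simp
  also have "(\<lambda>i. \<Sum>j<n. toeplitz a i j * (x j / r)) = (\<lambda>i. (1 / r) * (\<Sum>j<n. toeplitz a i j * x j))"
    by (simp add: sum_divide_distrib)
  also have "L2_set \<dots> {..<n} = (1 / r) * L2_set (\<lambda>i. (\<Sum>j<n. toeplitz a i j * x j)) {..<n}"
    using r by (subst L2_set_right_distrib) auto
  finally show ?thesis using r by (simp add: r_def[symmetric] field_simps)
qed

text \<open>The matrix depends linearly on the sequence, so the triangle inequality reduces this to
  the Schur test for the difference. The estimate later controls the change of one variable, the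
  truncation error and, through continuity, measurability.\<close>

lemma toeplitz_norm_diff_le: "toeplitz_norm n a \<le> toeplitz_norm n b + 2 * (\<Sum>k<n. \<bar>a k - b k\<bar>)"
proof (rule toeplitz_norm_le)
  fix x :: "nat \<Rightarrow> real" assume x: "(\<Sum>j<n. (x j)\<^sup>2) \<le> 1"
  then have x1: "L2_set x {..<n} \<le> 1" by (simp add: L2_set_def)
  have "L2_set (\<lambda>i. \<Sum>j<n. toeplitz a i j * x j) {..<n}
      = L2_set (\<lambda>i. (\<Sum>j<n. toeplitz b i j * x j) + (\<Sum>j<n. toeplitz (\<lambda>k. a k - b k) i j * x j)) {..<n}"
    by (simp add: toeplitz_diff sum.distrib[symmetric] algebra_simps)
  also have "\<dots> \<le> L2_set (\<lambda>i. (\<Sum>j<n. toeplitz b i j * x j)) {..<n} + L2_set (\<lambda>i. \<Sum>j<n. toeplitz (\<lambda>k. a k - b k) i j * x j) {..<n}"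
    by (rule L2_set_triangle_ineq)
  also have "\<dots> \<le> toeplitz_norm n b + 2 * (\<Sum>k<n. \<bar>a k - b k\<bar>)"
    using x x1 by (intro add_mono toeplitz_norm_ge order_trans[OF toeplitz_mult_le] mult_left_le) (auto simp: sum_nonneg)
  finally show "L2_set (\<lambda>i. \<Sum>j<n. toeplitz a i j * x j) {..<n} \<le> \<dots>" .
qed

lemma abs_toeplitz_norm_diff_le:
  "\<bar>toeplitz_norm n a - toeplitz_norm n b\<bar> \<le> 2 * (\<Sum>k<n. \<bar>a k - b k\<bar>)"
  using toeplitz_norm_diff_le[of n a b] toeplitz_norm_diff_le[of n b a]
  by (simp add: abs_le_iff abs_minus_commute)

lemma toeplitz_norm_le_sum: "toeplitz_norm n a \<le> 2 * (\<Sum>k<n. \<bar>a k\<bar>)"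
proof (rule toeplitz_norm_le)
  fix x :: "nat \<Rightarrow> real" assume "(\<Sum>j<n. (x j)\<^sup>2) \<le> 1"
  then have "L2_set x {..<n} \<le> 1" by (simp add: L2_set_def)
  then show "L2_set (\<lambda>i. \<Sum>j<n. toeplitz a i j * x j) {..<n} \<le> 2 * (\<Sum>k<n. \<bar>a k\<bar>)"
    by (intro order_trans[OF toeplitz_mult_le] mult_left_le) (auto simp: sum_nonneg)
qed

lemma toeplitz_norm_cong:
  assumes "\<And>k. k < n \<Longrightarrow> a k = b k"
  shows "toeplitz_norm n a = toeplitz_norm n b"
  using abs_toeplitz_norm_diff_le[of n a b] assms by simp

text \<open>The smaller matrix is a leading principal submatrix of the larger one: pad the test
  vector with zeros and drop the extra output coordinates.\<close>

lemma toeplitz_norm_mono: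
  assumes "n \<le> m"
  shows "toeplitz_norm n a \<le> toeplitz_norm m a"
proof (rule toeplitz_norm_le)
  fix x :: "nat \<Rightarrow> real" assume x: "(\<Sum>j<n. (x j)\<^sup>2) \<le> 1"
  define y where "y j = (if j < n then x j else 0)" for j
  have ext: "(\<Sum>j<m. f j (y j)) = (\<Sum>j<n. f j (x j))" if "\<And>j. f j 0 = 0" for f :: "nat \<Rightarrow> real \<Rightarrow> real"
    using assms that by (intro sum.mono_neutral_cong_right) (auto simp: y_def)
  have "L2_set (\<lambda>i. \<Sum>j<n. toeplitz a i j * x j) {..<n} = L2_set (\<lambda>i. \<Sum>j<m. toeplitz a i j * y j) {..<n}"
    using ext[of "\<lambda>j t. toeplitz a _ j * t"] by simp
  also have "\<dots> \<le> L2_set (\<lambda>i. \<Sum>j<m. toeplitz a i j * y j) {..<m}"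
    using assms unfolding L2_set_def by (auto intro!: sum_mono2)
  also have "\<dots> \<le> toeplitz_norm m a"
    using x by (intro toeplitz_norm_ge) (simp add: ext[of "\<lambda>_ t. t\<^sup>2"])
  finally show "L2_set (\<lambda>i. \<Sum>j<n. toeplitz a i j * x j) {..<n} \<le> toeplitz_norm m a" .
qed

text \<open>Continuity is in the product topology on sequences, where the Lipschitz bound suffices
  because it involves finitely many coordinates. It makes the norm a random variable although it is
  a supremum over uncountably many vectors.\<close>

lemma continuous_toeplitz_norm: "continuous_on UNIV (toeplitz_norm n)"
proof (rule continuous_at_imp_continuous_on, clarify)
  fix a :: "nat \<Rightarrow> real"
  have "((\<lambda>b. 2 * (\<Sum>k<n. \<bar>b k - a k\<bar>)) \<longlongrightarrow> 2 * (\<Sum>k<n. \<bar>a k - a k\<bar>)) (at a)"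
    by (intro tendsto_intros continuous_on_product_coordinates[THEN continuous_on_eq_continuous_at[THEN iffD1, OF open_UNIV], rule_format, unfolded isCont_def]) auto
  then have "((\<lambda>b. toeplitz_norm n b - toeplitz_norm n a) \<longlongrightarrow> 0) (at a)"
    by (rule Lim_null_comparison[rotated, OF tendsto_eq_rhs]) (auto simp: abs_toeplitz_norm_diff_le)
  then show "isCont (toeplitz_norm n) a"
    unfolding isCont_def by (simp add: LIM_zero_iff)
qed

lemma borel_measurable_toeplitz_norm:
  assumes "\<And>k. f k \<in> borel_measurable M"
  shows "(\<lambda>\<omega>. toeplitz_norm n (\<lambda>k. f k \<omega>)) \<in> borel_measurable M"
  using assms
  by (intro measurable_compose[OF _ borel_measurable_continuous_onI[OF continuous_toeplitz_norm]]
      measurable_coordinatewise_then_product)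

text \<open>
  The vectors \<open>(cos (\<theta> j))\<close>, \<open>(sin (\<theta> j))\<close>, restricted to \<open>m \<le> j < 2 m\<close> on one side and to \<open>i < 3 m\<close>
  on the other, give a functional of \<open>a\<close> whose coefficients for \<open>1 \<le> k \<le> m\<close> carry no Fejer-type
  weights; this makes the coefficient vectors for different frequencies exactly orthogonal.
\<close>

definition trig_coeff :: "nat \<Rightarrow> real \<Rightarrow> nat \<Rightarrow> real" where
  "trig_coeff m \<theta> k = (\<Sum>j\<in>{m..<2*m}. \<Sum>i<3*m.
     if k = (if i \<le> j then j - i else i - j) then cos (\<theta> * (real i - real j)) else 0)"

text \<open>For \<open>j\<close> in the middle third, both \<open>j - k\<close> and
  \<open>j + k\<close> lie in \<open>{..<3*m}\<close>, and they differ since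
  \<open>k \<ge> 1\<close>. So each of the \<open>m\<close> values of \<open>j\<close> contributes
  the same two cosines, with no boundary loss.\<close>

lemma trig_coeff_eq:
  assumes "1 \<le> k" "k \<le> m"
  shows "trig_coeff m \<theta> k = 2 * real m * cos (\<theta> * real k)"
proof -
  have "(\<Sum>i<3*m. if k = (if i \<le> j then j - i else i - j) then cos (\<theta> * (real i - real j)) else 0)
      = 2 * cos (\<theta> * real k)" if j: "j \<in> {m..<2*m}" for j
  proof -
    have "(\<Sum>i<3*m. if k = (if i \<le> j then j - i else i - j) then cos (\<theta> * (real i - real j)) else 0)
       = (\<Sum>i\<in>{j - k, j + k}. cos (\<theta> * (real i - real j)))"
      using j assms by (intro sum.mono_neutral_cong_right) (auto split: if_splits)
    also have "\<dots> = cos (\<theta> * - real k) + cos (\<theta> * real k)"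
      using j assms by (simp add: of_nat_diff)
    finally show ?thesis by simp
  qed
  then show ?thesis by (simp add: trig_coeff_def)
qed

text \<open>The sum is the real part of the sesquilinear form of the matrix at two complex
  exponential vectors, one supported on all \<open>3 * m\<close> indices and one on the middle
  \<open>m\<close>; their norms are sqrt (3 m) and sqrt m.\<close>

lemma sum_trig_coeff_le_toeplitz_norm:
  "\<bar>\<Sum>k<3*m. trig_coeff m \<theta> k * a k\<bar> \<le> sqrt 3 * real m * toeplitz_norm (3*m) a"
proof -
  define T where "T = toeplitz_norm (3*m) a"
  define ind where "ind j = (if j \<in> {m..<2*m} then 1 else 0 :: real)" for j
  have bil: "\<bar>\<Sum>i<3*m. v i * (\<Sum>j<3*m. toeplitz a i j * u j)\<bar> \<le> T * (L2_set v {..<3*m} * L2_set u {..<3*m})" for u v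
  proof -
    have "\<bar>\<Sum>i<3*m. v i * (\<Sum>j<3*m. toeplitz a i j * u j)\<bar> \<le> (\<Sum>i<3*m. \<bar>v i\<bar> * \<bar>\<Sum>j<3*m. toeplitz a i j * u j\<bar>)"
      by (rule order_trans[OF sum_abs]) (simp add: abs_mult)
    also have "\<dots> \<le> L2_set v {..<3*m} * L2_set (\<lambda>i. \<Sum>j<3*m. toeplitz a i j * u j) {..<3*m}"
      by (rule L2_set_mult_ineq)
    also have "\<dots> \<le> L2_set v {..<3*m} * (T * L2_set u {..<3*m})"
      unfolding T_def by (intro mult_left_mono L2_set_toeplitz_le_norm) auto
    finally show ?thesis by (simp add: mult_ac)
  qed
  have "(\<Sum>k<3*m. trig_coeff m \<theta> k * a k)
     = (\<Sum>j\<in>{m..<2*m}. \<Sum>i<3*m. \<Sum>k<3*m. (if k = (if i \<le> j then j - i else i - j) then cos (\<theta> * (real i - real j)) else 0) * a k)"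
    unfolding trig_coeff_def sum_distrib_right
    by (subst sum.swap, rule sum.cong[OF refl], rule sum.swap)
  also have "\<dots> = (\<Sum>j\<in>{m..<2*m}. \<Sum>i<3*m. cos (\<theta> * (real i - real j)) * toeplitz a i j)"
  proof (intro sum.cong refl)
    fix i j assume "j \<in> {m..<2*m}" "i \<in> {..<3*m}"
    then have "(if i \<le> j then j - i else i - j) < 3*m" by auto
    then show "(\<Sum>k<3*m. (if k = (if i \<le> j then j - i else i - j) then cos (\<theta> * (real i - real j)) else 0) * a k)
       = cos (\<theta> * (real i - real j)) * toeplitz a i j"
      by (subst sum.mono_neutral_cong_right[where S = "{if i \<le> j then j - i else i - j}"
            and h = "\<lambda>k. cos (\<theta> * (real i - real j)) * a k"]) (auto simp: toeplitz_def)
  qed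
  also have "\<dots> = (\<Sum>j<3*m. \<Sum>i<3*m. ind j * (cos (\<theta> * (real i - real j)) * toeplitz a i j))"
    by (intro sum.mono_neutral_cong_left) (auto simp: ind_def)
  also have "\<dots> = (\<Sum>i<3*m. \<Sum>j<3*m. ind j * (cos (\<theta> * (real i - real j)) * toeplitz a i j))"
    by (rule sum.swap)
  also have "\<dots> = (\<Sum>i<3*m. cos (\<theta> * i) * (\<Sum>j<3*m. toeplitz a i j * (ind j * cos (\<theta> * j))))
       + (\<Sum>i<3*m. sin (\<theta> * i) * (\<Sum>j<3*m. toeplitz a i j * (ind j * sin (\<theta> * j))))"
    by (simp add: sum.distrib[symmetric] sum_distrib_left right_diff_distrib cos_diff algebra_simps)
  finally have "\<bar>\<Sum>k<3*m. trig_coeff m \<theta> k * a k\<bar> \<le> T * (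
      L2_set (\<lambda>i. cos (\<theta> * real i)) {..<3*m} * L2_set (\<lambda>j. ind j * cos (\<theta> * real j)) {..<3*m}
    + L2_set (\<lambda>i. sin (\<theta> * real i)) {..<3*m} * L2_set (\<lambda>j. ind j * sin (\<theta> * real j)) {..<3*m})"
    using bil[of "\<lambda>i. cos (\<theta> * real i)" "\<lambda>j. ind j * cos (\<theta> * real j)"]
      bil[of "\<lambda>i. sin (\<theta> * real i)" "\<lambda>j. ind j * sin (\<theta> * real j)"]
    by (simp add: distrib_left abs_if split: if_splits)
  also have "\<dots> \<le> T * (sqrt 3 * real m)"
  proof (rule mult_left_mono)
    define p q r s where "p = L2_set (\<lambda>i. cos (\<theta> * real i)) {..<3*m}"
      and "q = L2_set (\<lambda>j. ind j * cos (\<theta> * real j)) {..<3*m}"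
      and "r = L2_set (\<lambda>i. sin (\<theta> * real i)) {..<3*m}"
      and "s = L2_set (\<lambda>j. ind j * sin (\<theta> * real j)) {..<3*m}"
    \<comment> \<open>As cos^2 + sin^2 = 1, the squared lengths add up exactly to the numbers of
      indices. Cauchy-Schwarz in the plane then treats the cosine and sine parts together, without
      losing a factor 2.\<close>
    have pr: "p\<^sup>2 + r\<^sup>2 = 3 * real m"
      unfolding p_def r_def L2_set_def by (simp add: sum_nonneg sum.distrib[symmetric])
    have "q\<^sup>2 + s\<^sup>2 = (\<Sum>j<3*m. (ind j)\<^sup>2)"
      unfolding q_def s_def L2_set_def
      by (simp add: sum_nonneg sum.distrib[symmetric] power_mult_distrib distrib_left[symmetric])
    also have "\<dots> = (\<Sum>j\<in>{m..<2*m}. 1)"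
      by (intro sum.mono_neutral_cong_right) (auto simp: ind_def)
    finally have qs: "q\<^sup>2 + s\<^sup>2 = real m" by simp
    have "(p * q + r * s)\<^sup>2 \<le> (p\<^sup>2 + r\<^sup>2) * (q\<^sup>2 + s\<^sup>2)"
      using zero_le_power2[of "p * s - r * q"] by (simp add: power2_eq_square algebra_simps)
    also have "\<dots> = (sqrt 3 * real m)\<^sup>2"
      by (simp add: pr qs power_mult_distrib) (simp add: power2_eq_square)
    finally show "p * q + r * s \<le> sqrt 3 * real m"
      by (rule power2_le_imp_le) simp
  qed (simp add: T_def toeplitz_norm_nonneg)
  finally show ?thesis by (simp add: T_def mult_ac)
qed

section \<open>Concentration\<close>

text \<open>
  The martingale \<open>E[f | x 0, \<dots>, x (k - 1)]\<close> has increments bounded by \<open>h (x k) + E h\<close>, a quantity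
  independent of the past; the cross term \<open>4 S D ^ 3\<close> is absorbed by \<open>2 S ^ 2 D ^ 2 + 2 D ^ 4\<close>.
\<close>

lemma product_fourth_moment_bound:
  fixes f :: "(nat \<Rightarrow> 'b) \<Rightarrow> real" and h :: "'b \<Rightarrow> real" and N :: "'b measure"
  assumes N: "prob_space N"
    and h[measurable]: "h \<in> borel_measurable N" and hK: "\<And>u. u \<in> space N \<Longrightarrow> \<bar>h u\<bar> \<le> K"
    and f: "f \<in> borel_measurable (PiM {..<n} (\<lambda>_. N))"
    and fB: "\<And>x. x \<in> space (PiM {..<n} (\<lambda>_. N)) \<Longrightarrow> \<bar>f x\<bar> \<le> B"
    and lip: "\<And>x j v. x \<in> space (PiM {..<n} (\<lambda>_. N)) \<Longrightarrow> j < n \<Longrightarrow> v \<in> space N \<Longrightarrow>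
                \<bar>f x - f (x(j := v))\<bar> \<le> h (x j) + h v"
    and G_def: "G = (\<lambda>u. h u + (\<integral>v. h v \<partial>N))"
    and q2_def: "q2 = (\<integral>u. (G u)\<^sup>2 \<partial>N)" and q4_def: "q4 = (\<integral>u. (G u) ^ 4 \<partial>N)"
  shows "(\<integral>x. (f x - (\<integral>x. f x \<partial>PiM {..<n} (\<lambda>_. N)))\<^sup>2 \<partial>PiM {..<n} (\<lambda>_. N)) \<le> n * q2 \<and>
         (\<integral>x. (f x - (\<integral>x. f x \<partial>PiM {..<n} (\<lambda>_. N))) ^ 4 \<partial>PiM {..<n} (\<lambda>_. N)) \<le> 8 * n\<^sup>2 * q2\<^sup>2 + 3 * n * q4"
  using f fB lip
proof (induction n arbitrary: f)
  case 0
  then show ?case by (simp add: PiM_empty lebesgue_integral_count_space_finite)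
next
  case (Suc n f)
  interpret N: prob_space N by fact
  interpret PS: product_sigma_finite "\<lambda>_::nat. N" by standard
  define P where "P = PiM {..<n} (\<lambda>_. N)"
  interpret P: prob_space P unfolding P_def by (rule prob_space_PiM) (rule N)
  define P' where "P' = PiM {..<Suc n} (\<lambda>_. N)"
  have P'_eq: "P' = PiM (insert n {..<n}) (\<lambda>_. N)" by (simp add: P'_def lessThan_Suc)
  interpret P': prob_space P' unfolding P'_def by (rule prob_space_PiM) (rule N)
  have f[measurable]: "f \<in> borel_measurable P'"
    and fB: "\<And>x. x \<in> space P' \<Longrightarrow> \<bar>f x\<bar> \<le> B"
    and lip: "\<And>x j v. x \<in> space P' \<Longrightarrow> j < Suc n \<Longrightarrow> v \<in> space N \<Longrightarrow> \<bar>f x - f (x(j := v))\<bar> \<le> h (x j) + h v"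
    unfolding P'_def by (fact Suc.prems)+
  have upd: "x(n := y) \<in> space P'" if "x \<in> space P" "y \<in> space N" for x y
    using that by (auto simp: P_def P'_eq space_PiM PiE_iff extensional_def)
  have upd_j: "x(j := v) \<in> space P" if "x \<in> space P" "v \<in> space N" "j < n" for x v j
    using that by (auto simp: P_def space_PiM PiE_iff extensional_def)
  have meas2[measurable]: "(\<lambda>(x, y). f (x(n := y))) \<in> borel_measurable (P \<Otimes>\<^sub>M N)"
    using measurable_compose[OF measurable_add_dim f[unfolded P'_eq]]
    by (simp add: P_def case_prod_unfold)
  have meas1[measurable]: "(\<lambda>y. f (x(n := y))) \<in> borel_measurable N" if "x \<in> space P" for x
    using measurable_compose[OF measurable_Pair1'[OF that] meas2] by simp
  have int1: "integrable N (\<lambda>y. f (x(n := y)))" if "x \<in> space P" for x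
    using that by (intro N.integrable_bounded[of _ B]) (auto intro: fB upd)
  \<comment> \<open>\<open>f1\<close> is the conditional expectation given the first
    \<open>n\<close> coordinates. Averaging preserves the bounds on single-coordinate changes, so
    the induction hypothesis applies to it.\<close>
  define f1 where "f1 x = (\<integral>y. f (x(n := y)) \<partial>N)" for x
  have f1_meas[measurable]: "f1 \<in> borel_measurable P"
    unfolding f1_def using meas2 by (rule N.borel_measurable_lebesgue_integral)
  have f1_B: "\<bar>f1 x\<bar> \<le> B" if "x \<in> space P" for x
    using N.abs_integral_le[of "\<lambda>_. B" "\<lambda>y. f (x(n := y))"] that
    by (simp add: f1_def fB upd N.prob_space)
  have f1_lip: "\<bar>f1 x - f1 (x(j := v))\<bar> \<le> h (x j) + h v"
    if "x \<in> space P" "j < n" "v \<in> space N" for x j v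
  proof -
    have "f1 x - f1 (x(j := v)) = (\<integral>y. f (x(n := y)) - f ((x(j := v))(n := y)) \<partial>N)"
      unfolding f1_def using that by (intro Bochner_Integration.integral_diff[symmetric] int1 upd_j)
    also have "\<bar>\<dots>\<bar> \<le> (\<integral>y. h (x j) + h v \<partial>N)"
    proof (rule N.abs_integral_le)
      fix y assume "y \<in> space N"
      then show "\<bar>f (x(n := y)) - f ((x(j := v))(n := y))\<bar> \<le> h (x j) + h v"
        using lip[OF upd, of x y j v] that by (simp add: fun_upd_twist)
    qed simp
    finally show ?thesis by (simp add: N.prob_space)
  qed
  define E where "E = (\<integral>x. f x \<partial>P')"
  have int_f: "integrable P' f"
    by (rule P'.integrable_bounded[of _ B]) (auto intro: fB)
  have E1: "(\<integral>x. f1 x \<partial>P) = E"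
    unfolding E_def f1_def P_def P'_eq
    by (rule PS.product_integral_insert[symmetric]) (use int_f in \<open>auto simp: P'_eq\<close>)
  have E_B: "\<bar>E\<bar> \<le> B"
    using P'.abs_integral_le[of "\<lambda>_. B" f] by (simp add: E_def fB P'.prob_space)
  have [measurable]: "G \<in> borel_measurable N" unfolding G_def by measurable
  have int_h: "integrable N h" by (rule N.integrable_bounded[of _ K]) (auto intro: hK)
  have GK: "\<bar>G u\<bar> \<le> K + \<bar>\<integral>v. h v \<partial>N\<bar>" if "u \<in> space N" for u
    using hK[OF that] by (simp add: G_def)
  have int_G: "integrable N (\<lambda>u. (G u) ^ k)" for k
    by (rule N.integrable_bounded[of _ "(K + \<bar>\<integral>v. h v \<partial>N\<bar>) ^ k"])
       (auto simp: power_abs intro!: power_mono GK)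
  have q2: "q2 \<ge> 0" and q4: "q4 \<ge> 0" by (auto simp: q2_def q4_def)
  have D: "\<bar>f (x(n := y)) - f1 x\<bar> \<le> G y" if "x \<in> space P" "y \<in> space N" for x y
  proof -
    have "f (x(n := y)) - f1 x = (\<integral>w. f (x(n := y)) - f (x(n := w)) \<partial>N)"
      unfolding f1_def using int1[OF that(1)] by (simp add: N.prob_space)
    also have "\<bar>\<dots>\<bar> \<le> (\<integral>w. h y + h w \<partial>N)"
    proof (rule N.abs_integral_le)
      fix w assume "w \<in> space N"
      then show "\<bar>f (x(n := y)) - f (x(n := w))\<bar> \<le> h y + h w"
        using lip[OF upd[OF that], of n w] by simp
    qed (use int_h in simp)
    finally show ?thesis using int_h by (simp add: N.prob_space G_def)
  qed
  have inner2: "(\<integral>y. (f (x(n := y)) - E)\<^sup>2 \<partial>N) \<le> (f1 x - E)\<^sup>2 + q2" 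
    and inner4: "(\<integral>y. (f (x(n := y)) - E) ^ 4 \<partial>N) \<le> (f1 x - E) ^ 4 + 8 * (f1 x - E)\<^sup>2 * q2 + 3 * q4"
    if x: "x \<in> space P" for x
  proof -
    define S where "S = f1 x - E"
    define D where "D y = f (x(n := y)) - f1 x" for y
    have [measurable]: "(\<lambda>y. f (x(n := y))) \<in> borel_measurable N" using x by measurable
    have DG: "\<bar>D y\<bar> \<le> G y" if "y \<in> space N" for y using D[OF x that] by (simp add: D_def)
    \<comment> \<open>\<open>D\<close> is a martingale difference: terms linear in it integrate to 0
      once \<open>S\<close>, which depends only on the past, is fixed.\<close>
    have intD: "integrable N D" and D0: "(\<integral>y. D y \<partial>N) = 0"
      using int1[OF x] by (auto simp: D_def[abs_def] f1_def N.prob_space)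
    have SD: "f (x(n := y)) - E = S + D y" for y by (simp add: S_def D_def)
    have bd: "\<bar>S + D y\<bar> \<le> 2 * B" if "y \<in> space N" for y
      using fB[OF upd[OF x that]] E_B unfolding SD[symmetric] by linarith
    have int_SD: "integrable N (\<lambda>y. (S + D y) ^ k)" for k
    proof (rule N.integrable_bounded[of _ "(2 * B) ^ k"])
      fix y assume "y \<in> space N"
      then show "\<bar>(S + D y) ^ k\<bar> \<le> (2 * B) ^ k" unfolding power_abs by (intro power_mono bd) auto
    qed (simp add: D_def)
    have "(\<integral>y. (S + D y)\<^sup>2 \<partial>N) \<le> (\<integral>y. S\<^sup>2 + 2 * S * D y + (G y)\<^sup>2 \<partial>N)"
    proof (rule integral_mono)
      fix y assume "y \<in> space N"
      then have "(D y)\<^sup>2 \<le> (G y)\<^sup>2" using DG by (simp add: abs_le_square_iff[symmetric] order_trans[OF _ abs_ge_self])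
      then show "(S + D y)\<^sup>2 \<le> S\<^sup>2 + 2 * S * D y + (G y)\<^sup>2" by (simp add: power2_sum)
    qed (use int_SD intD int_G in auto)
    also have "\<dots> = S\<^sup>2 + q2"
      using intD int_G D0 by (simp add: N.prob_space q2_def)
    finally show "(\<integral>y. (f (x(n := y)) - E)\<^sup>2 \<partial>N) \<le> (f1 x - E)\<^sup>2 + q2"
      unfolding SD by (simp add: S_def)
    have "(\<integral>y. (S + D y) ^ 4 \<partial>N) \<le> (\<integral>y. S ^ 4 + 4 * S ^ 3 * D y + 8 * S\<^sup>2 * (G y)\<^sup>2 + 3 * (G y) ^ 4 \<partial>N)"
    proof (rule integral_mono)
      fix y assume "y \<in> space N"
      then have 2: "(D y)\<^sup>2 \<le> (G y)\<^sup>2" using DG by (simp add: abs_le_square_iff[symmetric] order_trans[OF _ abs_ge_self])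
      have 4: "(D y) ^ 4 \<le> (G y) ^ 4"
        using power_mono[OF 2 zero_le_power2, of 2] unfolding power_mult[symmetric] by simp
      have "(S + D y) ^ 4 = S ^ 4 + 4 * S ^ 3 * D y + 8 * S\<^sup>2 * (D y)\<^sup>2 + 3 * (D y) ^ 4 - 2 * (S * D y - (D y)\<^sup>2)\<^sup>2"
        by (simp add: power2_eq_square power3_eq_cube power4_eq_xxxx algebra_simps)
      also have "\<dots> \<le> S ^ 4 + 4 * S ^ 3 * D y + 8 * S\<^sup>2 * (D y)\<^sup>2 + 3 * (D y) ^ 4" by simp
      also have "\<dots> \<le> S ^ 4 + 4 * S ^ 3 * D y + 8 * S\<^sup>2 * (G y)\<^sup>2 + 3 * (G y) ^ 4"
        using 2 4 mult_left_mono[OF 2, of "8 * S\<^sup>2"] by simp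
      finally show "(S + D y) ^ 4 \<le> S ^ 4 + 4 * S ^ 3 * D y + 8 * S\<^sup>2 * (G y)\<^sup>2 + 3 * (G y) ^ 4" .
    qed (use int_SD intD int_G in auto)
    also have "\<dots> = S ^ 4 + 8 * S\<^sup>2 * q2 + 3 * q4"
      using intD int_G D0 by (simp add: N.prob_space q2_def q4_def)
    finally show "(\<integral>y. (f (x(n := y)) - E) ^ 4 \<partial>N) \<le> (f1 x - E) ^ 4 + 8 * (f1 x - E)\<^sup>2 * q2 + 3 * q4"
      unfolding SD by (simp add: S_def)
  qed
  have IH: "(\<integral>x. (f1 x - E)\<^sup>2 \<partial>P) \<le> n * q2"
    "(\<integral>x. (f1 x - E) ^ 4 \<partial>P) \<le> 8 * n\<^sup>2 * q2\<^sup>2 + 3 * n * q4"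
    using Suc.IH[OF f1_meas[unfolded P_def] f1_B[unfolded P_def] f1_lip[unfolded P_def], folded P_def]
    unfolding E1 by auto
  have int_f1E: "integrable P (\<lambda>x. (f1 x - E) ^ k)" for k
  proof (rule P.integrable_bounded[of _ "(2 * B) ^ k"])
    fix x assume "x \<in> space P"
    then have "\<bar>f1 x - E\<bar> \<le> 2 * B" using f1_B[of x] E_B by linarith
    then show "\<bar>(f1 x - E) ^ k\<bar> \<le> (2 * B) ^ k" unfolding power_abs by (intro power_mono) auto
  qed measurable
  have fE_B: "\<bar>(f x - E) ^ k\<bar> \<le> (2 * B) ^ k" if "x \<in> space P'" for k x
  proof -
    have "\<bar>f x - E\<bar> \<le> 2 * B" using fB[OF that] E_B by linarith
    then show ?thesis unfolding power_abs by (intro power_mono) auto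
  qed
  have ins: "(\<integral>x. (f x - E) ^ k \<partial>P') = (\<integral>x. (\<integral>y. (f (x(n := y)) - E) ^ k \<partial>N) \<partial>P)" for k
  proof -
    have "integrable P' (\<lambda>x. (f x - E) ^ k)"
      by (rule P'.integrable_bounded[of _ "(2 * B) ^ k"]) (use fE_B in auto)
    then show ?thesis
      unfolding P_def P'_eq by (intro PS.product_integral_insert) auto
  qed
  have int_inner: "integrable P (\<lambda>x. (\<integral>y. (f (x(n := y)) - E) ^ k \<partial>N))" for k
  proof (rule P.integrable_bounded[of _ "(2 * B) ^ k"])
    have "(\<lambda>(x, y). (f (x(n := y)) - E) ^ k) \<in> borel_measurable (P \<Otimes>\<^sub>M N)"
      using meas2 unfolding case_prod_unfold by measurable
    then show "(\<lambda>x. (\<integral>y. (f (x(n := y)) - E) ^ k \<partial>N)) \<in> borel_measurable P"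
      by (rule N.borel_measurable_lebesgue_integral)
    fix x assume x: "x \<in> space P"
    have "\<bar>\<integral>y. (f (x(n := y)) - E) ^ k \<partial>N\<bar> \<le> (\<integral>y. (2 * B) ^ k \<partial>N)"
      by (rule N.abs_integral_le) (use fE_B[OF upd[OF x]] in auto)
    then show "\<bar>\<integral>y. (f (x(n := y)) - E) ^ k \<partial>N\<bar> \<le> (2 * B) ^ k"
      by (simp add: N.prob_space)
  qed
  have "(\<integral>x. (f x - E)\<^sup>2 \<partial>P') \<le> (\<integral>x. (f1 x - E)\<^sup>2 + q2 \<partial>P)"
    unfolding ins using int_inner int_f1E inner2 by (intro integral_mono) auto
  also have "\<dots> \<le> Suc n * q2"
    using IH int_f1E by (simp add: P.prob_space algebra_simps)
  finally have 2: "(\<integral>x. (f x - E)\<^sup>2 \<partial>P') \<le> Suc n * q2" .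
  have "(\<integral>x. (f x - E) ^ 4 \<partial>P') \<le> (\<integral>x. (f1 x - E) ^ 4 + 8 * (f1 x - E)\<^sup>2 * q2 + 3 * q4 \<partial>P)"
    unfolding ins using int_inner int_f1E inner4 by (intro integral_mono) auto
  also have "\<dots> = (\<integral>x. (f1 x - E) ^ 4 \<partial>P) + 8 * q2 * (\<integral>x. (f1 x - E)\<^sup>2 \<partial>P) + 3 * q4"
    using int_f1E by (simp add: P.prob_space algebra_simps)
  \<comment> \<open>The second moment bound enters the fourth moment recursion here, which is why
    both are proved in one induction. The recursion closes since 8 n^2 + 8 n \<le> 8 (n +
    1)^2.\<close>
  also have "\<dots> \<le> (8 * n\<^sup>2 * q2\<^sup>2 + 3 * n * q4) + 8 * q2 * (n * q2) + 3 * q4"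
    using IH q2 by (intro add_mono mult_left_mono) auto
  also have "\<dots> \<le> 8 * (Suc n)\<^sup>2 * q2\<^sup>2 + 3 * Suc n * q4"
    using q2 by (simp add: power2_eq_square algebra_simps)
  finally show ?case using 2 by (simp add: E_def P'_def)
qed

section \<open>Maxima of trigonometric sums\<close>

lemma abs_exp_minus_quadratic_le:
  fixes t :: real
  assumes "\<bar>t\<bar> \<le> 1"
  shows "\<bar>exp t - (1 + t + t\<^sup>2 / 2)\<bar> \<le> \<bar>t\<bar> ^ 3"
proof -
  obtain u where u: "\<bar>u\<bar> \<le> \<bar>t\<bar>" "exp t = (\<Sum>m<3. t ^ m / fact m) + exp u / fact 3 * t ^ 3"
    using Maclaurin_exp_le[of t 3] by auto
  have "exp u \<le> exp 1" using u assms by simp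
  also have "\<dots> \<le> (3::real)" by (rule exp_le)
  finally have "exp u / fact 3 \<le> 1" by (simp add: fact_numeral)
  moreover have "exp t - (1 + t + t\<^sup>2 / 2) = exp u / fact 3 * t ^ 3"
    using u(2) by (simp add: eval_nat_numeral)
  ultimately have "\<bar>exp t - (1 + t + t\<^sup>2 / 2)\<bar> = exp u / fact 3 * \<bar>t\<bar> ^ 3"
    by (simp add: abs_mult power_abs)
  also have "\<dots> \<le> 1 * \<bar>t\<bar> ^ 3"
    using \<open>exp u / fact 3 \<le> 1\<close> by (intro mult_right_mono) auto
  finally show ?thesis by simp
qed

text \<open>Second-order expansion of the cumulant generating function with a cubic error. Keeping
  the error in the exponent makes the bounds multiply cleanly over independent variables.\<close>

lemma (in prob_space) exp_moment_bounds:
  fixes Y :: "'a \<Rightarrow> real"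
  assumes Y[measurable]: "Y \<in> borel_measurable M" and Yb: "\<And>\<omega>. \<bar>Y \<omega>\<bar> \<le> b"
    and Y0: "expectation Y = 0" and s2: "s2 = expectation (\<lambda>\<omega>. (Y \<omega>)\<^sup>2)"
  shows "\<exists>C\<ge>0. \<exists>x0>0. \<forall>x. \<bar>x\<bar> \<le> x0 \<longrightarrow>
     exp (s2 * x\<^sup>2 / 2 - C * \<bar>x\<bar> ^ 3) \<le> expectation (\<lambda>\<omega>. exp (x * Y \<omega>)) \<and>
     expectation (\<lambda>\<omega>. exp (x * Y \<omega>)) \<le> exp (s2 * x\<^sup>2 / 2 + C * \<bar>x\<bar> ^ 3)"
proof -
  have b: "b \<ge> 0" using Yb[of undefined] by linarith
  \<comment> \<open>\<open>K * x\<^sup>2\<close> will bound the distance of the exponential moment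
    from 1. In \<open>C\<close>, the Taylor remainder accounts for \<open>b ^ 3\<close> and passing
    to the logarithm for \<open>2 * K\<^sup>2\<close>; \<open>x0\<close> keeps
    \<open>\<bar>x\<bar> * b\<close>, \<open>\<bar>x\<bar> * K\<close> and
    \<open>\<bar>x\<bar>\<close> below 1/2.\<close>
  define K where "K = s2 / 2 + b\<^sup>2"
  have K: "K \<ge> 0" by (simp add: K_def s2)
  define C where "C = b ^ 3 + 2 * K\<^sup>2"
  define x0 where "x0 = 1 / (2 * (b + K + 1))"
  have int1: "integrable M (\<lambda>\<omega>. (Y \<omega>) ^ k)" for k
    by (rule integrable_const_bound[of _ "b ^ k"]) (auto simp: power_abs intro!: power_mono Yb)
  have main: "exp (s2 * x\<^sup>2 / 2 - C * \<bar>x\<bar> ^ 3) \<le> expectation (\<lambda>\<omega>. exp (x * Y \<omega>)) \<and>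
     expectation (\<lambda>\<omega>. exp (x * Y \<omega>)) \<le> exp (s2 * x\<^sup>2 / 2 + C * \<bar>x\<bar> ^ 3)" if x: "\<bar>x\<bar> \<le> x0" for x
  proof -
    have xb: "\<bar>x\<bar> * (b + K + 1) \<le> 1/2" using x b K by (simp add: x0_def field_simps)
    have "\<bar>x\<bar> * b \<ge> 0" "\<bar>x\<bar> * K \<ge> 0" using b K by auto
    moreover have "\<bar>x\<bar> * b + \<bar>x\<bar> * K + \<bar>x\<bar> \<le> 1/2" using xb by (simp add: distrib_left)
    ultimately have x1: "\<bar>x\<bar> * b \<le> 1/2" "\<bar>x\<bar> * K \<le> 1/2" "\<bar>x\<bar> \<le> 1/2" by linarith+
    have xY: "\<bar>x * Y \<omega>\<bar> \<le> \<bar>x\<bar> * b" for \<omega> using Yb[of \<omega>] by (auto simp: abs_mult intro: mult_left_mono)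
    have inte: "integrable M (\<lambda>\<omega>. exp (x * Y \<omega>))"
    proof (rule integrable_const_bound[of _ "exp 1"])
      show "AE \<omega> in M. norm (exp (x * Y \<omega>)) \<le> exp 1"
      proof (rule AE_I2)
        fix \<omega> show "norm (exp (x * Y \<omega>)) \<le> exp 1" using xY[of \<omega>] x1 by (simp add: abs_le_iff)
      qed
    qed simp
    define u where "u = expectation (\<lambda>\<omega>. exp (x * Y \<omega>)) - 1"
    have "expectation (\<lambda>\<omega>. exp (x * Y \<omega>) - (1 + x * Y \<omega> + x\<^sup>2 / 2 * (Y \<omega>)\<^sup>2)) = u - s2 * x\<^sup>2 / 2"
      using inte int1[of 1] int1[of 2] Y0 by (simp add: u_def s2 prob_space)
    moreover have "\<bar>expectation (\<lambda>\<omega>. exp (x * Y \<omega>) - (1 + x * Y \<omega> + x\<^sup>2 / 2 * (Y \<omega>)\<^sup>2))\<bar> \<le> expectation (\<lambda>_. b ^ 3 * \<bar>x\<bar> ^ 3)"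
    proof (rule order_trans[OF integral_abs_bound], rule integral_mono)
      show "integrable M (\<lambda>\<omega>. \<bar>exp (x * Y \<omega>) - (1 + x * Y \<omega> + x\<^sup>2 / 2 * (Y \<omega>)\<^sup>2)\<bar>)"
        using inte int1[of 1] int1[of 2] by simp
      fix \<omega>
      have "\<bar>exp (x * Y \<omega>) - (1 + x * Y \<omega> + (x * Y \<omega>)\<^sup>2 / 2)\<bar> \<le> \<bar>x * Y \<omega>\<bar> ^ 3"
        using xY[of \<omega>] x1 by (intro abs_exp_minus_quadratic_le) linarith
      also have "\<dots> \<le> (\<bar>x\<bar> * b) ^ 3" using xY by (intro power_mono) auto
      finally show "\<bar>exp (x * Y \<omega>) - (1 + x * Y \<omega> + x\<^sup>2 / 2 * (Y \<omega>)\<^sup>2)\<bar> \<le> b ^ 3 * \<bar>x\<bar> ^ 3"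
        by (simp add: power_mult_distrib mult_ac)
    qed simp
    ultimately have u: "\<bar>u - s2 * x\<^sup>2 / 2\<bar> \<le> b ^ 3 * \<bar>x\<bar> ^ 3"
      by (simp add: prob_space)
    have "b ^ 3 * \<bar>x\<bar> ^ 3 = b\<^sup>2 * x\<^sup>2 * (\<bar>x\<bar> * b)"
      by (simp add: power3_eq_cube power2_eq_square mult_ac flip: abs_mult)
    also have "\<dots> \<le> b\<^sup>2 * x\<^sup>2" using x1 b by (intro mult_left_le) auto
    finally have "b ^ 3 * \<bar>x\<bar> ^ 3 \<le> b\<^sup>2 * x\<^sup>2" .
    moreover have "K * x\<^sup>2 = s2 * x\<^sup>2 / 2 + b\<^sup>2 * x\<^sup>2" by (simp add: K_def distrib_right)
    moreover have "s2 * x\<^sup>2 / 2 \<ge> 0" by (simp add: s2)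
    ultimately have uK: "\<bar>u\<bar> \<le> K * x\<^sup>2" using u by linarith
    have "K * x\<^sup>2 = (\<bar>x\<bar> * K) * \<bar>x\<bar>" by (simp add: power2_eq_square mult_ac flip: abs_mult)
    also have "\<dots> \<le> 1/2 * 1" using x1 K by (intro mult_mono) auto
    finally have u2: "\<bar>u\<bar> \<le> 1/2" using uK by simp
    have "u\<^sup>2 \<le> (K * x\<^sup>2)\<^sup>2" using uK by (simp add: abs_le_square_iff[symmetric] order_trans[OF _ abs_ge_self])
    also have "\<dots> = K\<^sup>2 * \<bar>x\<bar> ^ 3 * \<bar>x\<bar>" by (simp add: power2_eq_square power3_eq_cube mult_ac flip: abs_mult)
    also have "\<dots> \<le> K\<^sup>2 * \<bar>x\<bar> ^ 3" using x1 by (intro mult_left_le) auto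
    finally have u3: "u\<^sup>2 \<le> K\<^sup>2 * \<bar>x\<bar> ^ 3" .
    have "0 \<le> K\<^sup>2 * \<bar>x\<bar> ^ 3" by simp
    have "\<bar>ln (1 + u) - u\<bar> \<le> 2 * u\<^sup>2" using u2 by (rule abs_ln_one_plus_x_minus_x_bound)
    moreover have C: "C * \<bar>x\<bar> ^ 3 = b ^ 3 * \<bar>x\<bar> ^ 3 + 2 * (K\<^sup>2 * \<bar>x\<bar> ^ 3)" by (simp add: C_def distrib_right)
    ultimately have "ln (1 + u) \<ge> s2 * x\<^sup>2 / 2 - C * \<bar>x\<bar> ^ 3"
      using u u3 by linarith
    moreover have "1 + u > 0" using u2 by linarith
    ultimately have "exp (s2 * x\<^sup>2 / 2 - C * \<bar>x\<bar> ^ 3) \<le> 1 + u" by (simp add: ln_ge_iff)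
    moreover have "1 + u \<le> exp u" by (rule exp_ge_add_one_self)
    moreover have "u \<le> s2 * x\<^sup>2 / 2 + C * \<bar>x\<bar> ^ 3"
      using u C \<open>0 \<le> K\<^sup>2 * \<bar>x\<bar> ^ 3\<close> by linarith
    ultimately show ?thesis by (auto simp: u_def intro: order_trans)
  qed
  show ?thesis
  proof (rule exI[of _ C], intro conjI, goal_cases)
    case 1 show ?case using b by (simp add: C_def)
  next
    case 2 show ?case
    proof (rule exI[of _ x0], intro conjI allI impI, goal_cases)
      case 1 show ?case using b K by (simp add: x0_def)
    qed (use main in auto)
  qed
qed

text \<open>
  With \<open>y = \<Sum> exp (\<lambda> W i) / (N \<alpha>)\<close>, so that \<open>E y \<ge> 1\<close> and \<open>E y\<^sup>2 \<le> B\<close>, this is the Paley--Zygmund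
  argument in pointwise form: the indicator of \<open>y \<ge> 1/2\<close> dominates
  \<open>z / B - z\<^sup>2 / (4 B\<^sup>2)\<close> for \<open>z = y - 1/2\<close>.
\<close>

lemma (in prob_space) expectation_Max_ge:
  fixes W :: "'i \<Rightarrow> 'a \<Rightarrow> real"
  assumes J: "finite J" "J \<noteq> {}"
    and W[measurable]: "\<And>i. i \<in> J \<Longrightarrow> W i \<in> borel_measurable M"
    and Wb: "\<And>i \<omega>. i \<in> J \<Longrightarrow> \<bar>W i \<omega>\<bar> \<le> b"
    and l: "l > 0" and B: "B > 0" and \<alpha>: "\<alpha> \<ge> 2"
    and lower: "\<And>i. i \<in> J \<Longrightarrow> \<alpha> \<le> expectation (\<lambda>\<omega>. exp (l * W i \<omega>))"
    and upper: "(\<Sum>i\<in>J. \<Sum>j\<in>J. expectation (\<lambda>\<omega>. exp (l * (W i \<omega> + W j \<omega>)))) \<le> B * (real (card J))\<^sup>2 * \<alpha>\<^sup>2"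
  shows "expectation (\<lambda>\<omega>. MAX i\<in>J. \<bar>W i \<omega>\<bar>) \<ge> ln (\<alpha> / 2) / (4 * B * l)"
proof -
  define N where "N = real (card J)"
  have N: "N > 0" using J by (simp add: N_def card_gt_0_iff)
  define y where "y \<omega> = (\<Sum>i\<in>J. exp (l * W i \<omega>)) / (N * \<alpha>)" for \<omega>
  define R where "R \<omega> = (MAX i\<in>J. \<bar>W i \<omega>\<bar>)" for \<omega>
  have b: "b \<ge> 0" using J Wb[of "SOME i. i \<in> J" undefined] some_in_eq[of J] by (smt (verit))
  have R_ge: "\<bar>W i \<omega>\<bar> \<le> R \<omega>" if "i \<in> J" for i \<omega>
    unfolding R_def using J that by (intro Max_ge) auto
  have R_le: "R \<omega> \<le> b" for \<omega> unfolding R_def using J Wb by (intro Max.boundedI) auto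
  have R0: "R \<omega> \<ge> 0" for \<omega> using J R_ge[of _ \<omega>] by (meson abs_ge_zero ex_in_conv order_trans)
  have [measurable]: "R \<in> borel_measurable M"
    unfolding R_def[abs_def] using J by (intro borel_measurable_Max) auto
  have int_R: "integrable M R"
    by (rule integrable_const_bound[of _ b]) (use R0 R_le in auto)
  have int_e: "integrable M (\<lambda>\<omega>. exp (l * W i \<omega>))" "integrable M (\<lambda>\<omega>. exp (l * (W i \<omega> + W j \<omega>)))"
    if "i \<in> J" "j \<in> J" for i j
  proof -
    have "l * W i \<omega> \<le> l * (2 * b)" "l * (W i \<omega> + W j \<omega>) \<le> l * (2 * b)" for \<omega>
      using Wb[OF that(1), of \<omega>] Wb[OF that(2), of \<omega>] l b by (intro mult_left_mono; linarith)+
    then show "integrable M (\<lambda>\<omega>. exp (l * W i \<omega>))" "integrable M (\<lambda>\<omega>. exp (l * (W i \<omega> + W j \<omega>)))"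
      using that by (auto intro!: integrable_const_bound[of _ "exp (l * (2 * b))"])
  qed
  have int_y: "integrable M y"
    unfolding y_def[abs_def] using int_e by (intro integrable_divide Bochner_Integration.integrable_sum) auto
  have y2: "(y \<omega>)\<^sup>2 = (\<Sum>i\<in>J. \<Sum>j\<in>J. exp (l * (W i \<omega> + W j \<omega>))) / (N\<^sup>2 * \<alpha>\<^sup>2)" for \<omega>
    by (simp add: y_def power_divide power_mult_distrib power2_eq_square[of "sum _ _"] sum_product
        exp_add[symmetric] distrib_left)
  have int_y2: "integrable M (\<lambda>\<omega>. (y \<omega>)\<^sup>2)"
    unfolding y2 using int_e by (intro integrable_divide Bochner_Integration.integrable_sum) auto
  have Ey: "expectation y \<ge> 1"
  proof -
    have "expectation y = (\<Sum>i\<in>J. expectation (\<lambda>\<omega>. exp (l * W i \<omega>))) / (N * \<alpha>)"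
      unfolding y_def[abs_def] using int_e by (simp add: Bochner_Integration.integral_sum)
    moreover have "(\<Sum>i\<in>J. \<alpha>) \<le> (\<Sum>i\<in>J. expectation (\<lambda>\<omega>. exp (l * W i \<omega>)))"
      by (intro sum_mono lower)
    then have "N * \<alpha> \<le> (\<Sum>i\<in>J. expectation (\<lambda>\<omega>. exp (l * W i \<omega>)))" by (simp add: N_def)
    ultimately show ?thesis using N \<alpha> by (simp add: le_divide_eq)
  qed
  have Ey2: "expectation (\<lambda>\<omega>. (y \<omega>)\<^sup>2) \<le> B"
  proof -
    have "expectation (\<lambda>\<omega>. (y \<omega>)\<^sup>2) = (\<Sum>i\<in>J. \<Sum>j\<in>J. expectation (\<lambda>\<omega>. exp (l * (W i \<omega> + W j \<omega>)))) / (N\<^sup>2 * \<alpha>\<^sup>2)"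
      unfolding y2 using int_e by (simp add: Bochner_Integration.integral_sum)
    also have "\<dots> \<le> B" using upper N \<alpha> by (simp add: N_def field_simps)
    finally show ?thesis .
  qed
  define L where "L = ln (\<alpha> / 2)"
  have L: "L \<ge> 0" using \<alpha> by (simp add: L_def)
  define q where "q \<omega> = (y \<omega> - 1/2) / B - (y \<omega> - 1/2)\<^sup>2 / (4 * B\<^sup>2)" for \<omega>
  have q_eq: "q \<omega> = (y \<omega> - 1/2) / B - ((y \<omega>)\<^sup>2 - y \<omega> + 1/4) / (4 * B\<^sup>2)" for \<omega>
    by (simp add: q_def power2_eq_square algebra_simps)
  have int_q: "integrable M q"
    unfolding q_eq using int_y int_y2 by simp
  \<comment> \<open>The expectation increases with E y and decreases with E y^2, so the extreme case
    is E y = 1, E y^2 = B, with value 1/(2B) - 1/(4B) + 3/(16 B^2).\<close>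
  have Eq: "expectation q \<ge> 1 / (4 * B)"
  proof -
    have "expectation q = (expectation y - 1/2) / B - (expectation (\<lambda>\<omega>. (y \<omega>)\<^sup>2) - expectation y + 1/4) / (4 * B\<^sup>2)"
      unfolding q_eq using int_y int_y2 by (simp add: prob_space)
    also have "\<dots> \<ge> (1 - 1/2) / B - (B - 1 + 1/4) / (4 * B\<^sup>2)"
      using Ey Ey2 B by (intro diff_mono divide_right_mono) auto
    moreover have "(1 - 1/2) / B - (B - 1 + 1/4) / (4 * B\<^sup>2) \<ge> 1 / (4 * B)"
      using B by (simp add: field_simps power2_eq_square)
    ultimately show ?thesis by linarith
  qed
  have q_le: "L * q \<omega> \<le> l * R \<omega>" for \<omega>
  proof (cases "y \<omega> \<ge> 1/2")
    case True
    define z where "z = (y \<omega> - 1/2) / (2 * B)"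
    have "q \<omega> = 1 - (z - 1)\<^sup>2"
      using B by (simp add: q_def z_def power2_eq_square field_simps)
    then have "L * q \<omega> \<le> L" using L by (simp add: mult_left_le)
    \<comment> \<open>An average of exponentials is at most the exponential of
      \<open>l * R \<omega>\<close>, so \<open>y \<omega> \<ge> 1/2\<close> forces
      \<open>R \<omega> \<ge> L / l\<close>.\<close>
    have "\<alpha> * y \<omega> = (\<Sum>i\<in>J. exp (l * W i \<omega>)) / N" using \<alpha> by (simp add: y_def)
    also have "\<dots> \<le> (\<Sum>i\<in>J. exp (l * R \<omega>)) / N"
    proof (intro divide_right_mono sum_mono)
      fix i assume "i \<in> J"
      then have "W i \<omega> \<le> R \<omega>" using R_ge[of i \<omega>] by linarith
      then show "exp (l * W i \<omega>) \<le> exp (l * R \<omega>)" using l by simp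
    qed (use N in auto)
    also have "\<dots> = exp (l * R \<omega>)" using N by (simp add: N_def)
    finally have "\<alpha> * y \<omega> \<le> exp (l * R \<omega>)" .
    moreover have "\<alpha> / 2 \<le> \<alpha> * y \<omega>" using True \<alpha> by simp
    ultimately have "\<alpha> / 2 \<le> exp (l * R \<omega>)" by linarith
    then have "ln (\<alpha> / 2) \<le> ln (exp (l * R \<omega>))" using \<alpha> by (subst ln_le_cancel_iff) auto
    then have "L \<le> l * R \<omega>" by (simp add: L_def)
    then show ?thesis using \<open>L * q \<omega> \<le> L\<close> by linarith
  next
    case False
    then have "(y \<omega> - 1/2) / B \<le> 0" using B by (simp add: divide_le_0_iff)
    moreover have "(y \<omega> - 1/2)\<^sup>2 / (4 * B\<^sup>2) \<ge> 0" by simp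
    ultimately have "q \<omega> \<le> 0" unfolding q_def by linarith
    then have "L * q \<omega> \<le> 0" using L by (simp add: mult_nonneg_nonpos)
    also have "0 \<le> l * R \<omega>" using l R0 by simp
    finally show ?thesis .
  qed
  have "L / (4 * B) \<le> L * expectation q" using Eq L mult_left_mono by fastforce
  also have "\<dots> = expectation (\<lambda>\<omega>. L * q \<omega>)" by simp
  also have "\<dots> \<le> expectation (\<lambda>\<omega>. l * R \<omega>)"
    using int_q int_R q_le by (intro integral_mono) auto
  finally have "L / (4 * B) \<le> l * expectation R" by simp
  then show ?thesis using l B by (simp add: L_def R_def[abs_def] field_simps)
qed

text \<open>Multiplying by \<open>2 * sin h\<close> makes the sum telescope, and its end points
  differ by a multiple of the period. The assumption on \<open>l\<close> puts \<open>h\<close>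
  strictly between 0 and pi, so \<open>sin h\<close> can be cancelled.\<close>

lemma sum_cos_roots_of_unity:
  fixes l m :: nat
  assumes "0 < l" "l < m"
  shows "(\<Sum>k=1..m. cos (2 * pi * real l * real k / real m)) = 0"
proof -
  define h where "h = pi * real l / real m"
  have h: "0 < h" "h < pi" using assms by (auto simp: h_def field_simps)
  have "2 * sin h * (\<Sum>k=1..m. cos (2 * pi * real l * real k / real m))
      = (\<Sum>k=1..m. sin ((2 * real k + 1) * h) - sin ((2 * (real k - 1) + 1) * h))"
    unfolding sum_distrib_left
  proof (rule sum.cong[OF refl])
    fix k
    have "sin ((2 * real k + 1) * h) - sin ((2 * (real k - 1) + 1) * h)
        = sin (2 * real k * h + h) - sin (2 * real k * h - h)"
      by (simp add: algebra_simps)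
    also have "\<dots> = 2 * sin h * cos (2 * real k * h)" by (simp add: sin_add sin_diff)
    finally show "2 * sin h * cos (2 * pi * real l * real k / real m) = sin ((2 * real k + 1) * h) - sin ((2 * (real k - 1) + 1) * h)"
      by (simp add: h_def mult_ac)
  qed
  also have "\<dots> = (\<Sum>k=Suc 0..m. sin ((2 * real k + 1) * h) - sin ((2 * real (k - 1) + 1) * h))"
    by (intro sum.cong) (auto simp: of_nat_diff)
  also have "\<dots> = sin ((2 * real m + 1) * h) - sin h"
    by (subst sum_telescope'') auto
  also have "(2 * real m + 1) * h = h + 2 * real l * pi"
    using assms by (simp add: h_def field_simps)
  also have "sin \<dots> = sin h" by (simp add: sin_add)
  finally show ?thesis using sin_gt_zero[OF h] by simp
qed

text \<open>The factor 2 is chosen so that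
  \<open>trig_coeff m (2 * pi * i / m) k = m * dft m i k\<close> for
  \<open>1 \<le> k \<le> m\<close>.\<close>

definition dft :: "nat \<Rightarrow> nat \<Rightarrow> nat \<Rightarrow> real" where
  "dft m i k = 2 * cos (2 * pi * real i / real m * real k)"

text \<open>A product of cosines splits into the frequencies \<open>j - i\<close> and
  \<open>i + j\<close>. Since \<open>i + j < m\<close> there is no aliasing: each such frequency
  sums to 0 unless it is 0 itself.\<close>

lemma sum_dft_prod:
  assumes "1 \<le> i" "1 \<le> j" "i + j < m"
  shows "(\<Sum>k=1..m. dft m i k * dft m j k) = (if i = j then 2 * real m else 0)"
proof -
  have *: "(\<Sum>k=1..m. dft m i k * dft m j k) = (if i = j then 2 * real m else 0)"
    if "1 \<le> i" "i \<le> j" "i + j < m" for i j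
  proof -
    have "(\<Sum>k=1..m. dft m i k * dft m j k)
        = (\<Sum>k=1..m. 2 * cos (2 * pi * real (j - i) * real k / real m) + 2 * cos (2 * pi * real (j + i) * real k / real m))"
    proof (rule sum.cong[OF refl])
      fix k
      define x y where "x = 2 * pi * real i / real m * real k" and "y = 2 * pi * real j / real m * real k"
      have "dft m i k * dft m j k = 2 * cos (y - x) + 2 * cos (y + x)"
        unfolding dft_def x_def[symmetric] y_def[symmetric] by (simp add: cos_add cos_diff)
      also have "y - x = 2 * pi * real (j - i) * real k / real m"
        using that by (simp add: x_def y_def of_nat_diff diff_divide_distrib algebra_simps)
      also have "y + x = 2 * pi * real (j + i) * real k / real m"
        by (simp add: x_def y_def add_divide_distrib algebra_simps)
      finally show "dft m i k * dft m j k = 2 * cos (2 * pi * real (j - i) * real k / real m) + 2 * cos (2 * pi * real (j + i) * real k / real m)" .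
    qed
    also have "\<dots> = 2 * (\<Sum>k=1..m. cos (2 * pi * real (j - i) * real k / real m)) + 2 * (\<Sum>k=1..m. cos (2 * pi * real (j + i) * real k / real m))"
      by (simp add: sum.distrib sum_distrib_left)
    also have "(\<Sum>k=1..m. cos (2 * pi * real (j + i) * real k / real m)) = 0"
      using that by (intro sum_cos_roots_of_unity) auto
    also have "(\<Sum>k=1..m. cos (2 * pi * real (j - i) * real k / real m)) = (if i = j then real m else 0)"
      using that sum_cos_roots_of_unity[of "j - i" m] by (cases "i = j") auto
    finally show ?thesis by simp
  qed
  show ?thesis
  proof (cases "i \<le> j")
    case False
    then have "(\<Sum>k=1..m. dft m j k * dft m i k) = (if j = i then 2 * real m else 0)"
      using assms by (intro *) auto
    then show ?thesis by (simp add: mult.commute)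
  qed (use * assms in blast)
qed

section \<open>Conditioning on signs\<close>

text \<open>
  Conditioning on the signs of \<open>X 1, \<dots>, X m\<close> replaces each of these variables by a two-valued one and
  annihilates all the others; \<open>E X\<^sup>+ = d\<close> and \<open>P(X > 0) = p\<close>, so \<open>E[X | sgn X]\<close> is \<open>d / p\<close> or
  \<open>- d / (1 - p)\<close>.
\<close>

definition sgn_cond :: "real \<Rightarrow> real \<Rightarrow> real \<Rightarrow> real" where
  "sgn_cond d p x = (if x > 0 then d / p else - d / (1 - p))"

lemma borel_measurable_sgn_cond[measurable]: "sgn_cond d p \<in> borel_measurable borel"
  unfolding sgn_cond_def by measurable

lemma abs_sgn_cond_le: "\<bar>sgn_cond d p x\<bar> \<le> \<bar>d / p\<bar> + \<bar>d / (1 - p)\<bar>"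
  by (auto simp: sgn_cond_def abs_minus_commute)

text \<open>Conditional Jensen inequality made explicit. The signs of \<open>X 1, ..., X m\<close>
  split the space into atoms; on an atom, \<open>X k\<close> integrates like a constant for
  \<open>k \<in> {1..m}\<close>, and to 0 for every other \<open>k\<close>, which is centred and
  independent of the atom. The norm dominates each trigonometric functional, hence its integral over
  each atom.\<close>

lemma (in prob_space) expectation_toeplitz_norm_ge_Max:
  fixes X :: "nat \<Rightarrow> 'a \<Rightarrow> real"
  assumes indep: "indep_vars (\<lambda>_. borel) X UNIV"
    and int: "\<And>k. integrable M (X k)" and mean0: "\<And>k. expectation (X k) = 0"
    and d: "\<And>k. expectation (\<lambda>\<omega>. X k \<omega> * indicator {0<..} (X k \<omega>)) = d"
    and p: "\<And>k. expectation (\<lambda>\<omega>. indicator {0<..} (X k \<omega>)) = p"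
    and p01: "0 < p" "p < 1"
    and J: "finite J" "J \<noteq> {}" and m: "0 < m"
  shows "expectation (\<lambda>\<omega>. MAX i\<in>J. \<bar>\<Sum>k=1..m. dft m i k * sgn_cond d p (X k \<omega>)\<bar>)
           \<le> sqrt 3 * expectation (\<lambda>\<omega>. toeplitz_norm (3 * m) (\<lambda>k. X k \<omega>))"
proof -
  have X[measurable]: "X k \<in> borel_measurable M" for k
    using int by blast
  define \<xi> where "\<xi> = sgn_cond d p"
  have [measurable]: "\<xi> \<in> borel_measurable borel" by (simp add: \<xi>_def)
  define R where "R \<omega> = toeplitz_norm (3 * m) (\<lambda>k. X k \<omega>)" for \<omega>
  have R[measurable]: "R \<in> borel_measurable M"
    unfolding R_def[abs_def] by (rule borel_measurable_toeplitz_norm) simp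
  have int_R: "integrable M R"
  proof (rule Bochner_Integration.integrable_bound)
    show "integrable M (\<lambda>\<omega>. 2 * (\<Sum>k<3*m. \<bar>X k \<omega>\<bar>))" using int by auto
  qed (auto simp: R_def toeplitz_norm_nonneg toeplitz_norm_le_sum intro!: order_trans[OF _ abs_ge_self])
  define b where "b A k = (if k \<in> A then {0<..} else {..0::real})" for A :: "nat set" and k
  have b_borel[measurable]: "b A k \<in> sets borel" for A k by (simp add: b_def)
  \<comment> \<open>For \<open>A \<subseteq> {1..m}\<close>, \<open>Z A\<close> is the indicator of
    the atom on which exactly the variables with index in \<open>A\<close> are positive. The product
    form is what independence can factor.\<close>
  define Z where "Z A \<omega> = (\<Prod>k=1..m. indicator (b A k) (X k \<omega>) :: real)" for A \<omega>
  have Z[measurable]: "Z A \<in> borel_measurable M" for A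
    unfolding Z_def[abs_def] by measurable
  have Z01: "0 \<le> Z A \<omega>" "Z A \<omega> \<le> 1" for A \<omega>
    unfolding Z_def by (auto intro!: prod_nonneg prod_le_1 simp: indicator_def)
  have Z_eq: "Z A \<omega> = (if A = {k\<in>{1..m}. X k \<omega> > 0} then 1 else 0)" if "A \<subseteq> {1..m}" for A \<omega>
  proof (cases "A = {k\<in>{1..m}. X k \<omega> > 0}")
    case True
    then show ?thesis unfolding Z_def by (auto simp: b_def intro!: prod.neutral)
  next
    case False
    with that obtain k where "k \<in> {1..m}" "\<not> (k \<in> A \<longleftrightarrow> X k \<omega> > 0)" by blast
    then have "indicator (b A k) (X k \<omega>) = (0::real)" by (auto simp: b_def)
    then have "Z A \<omega> = 0" unfolding Z_def using \<open>k \<in> {1..m}\<close> by (intro prod_zero) auto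
    then show ?thesis using False by simp
  qed
  have Z_sum: "(\<Sum>A\<in>Pow {1..m}. g A * Z A \<omega>) = g {k\<in>{1..m}. X k \<omega> > 0}" for g :: "nat set \<Rightarrow> real" and \<omega>
  proof -
    have "(\<Sum>A\<in>Pow {1..m}. g A * Z A \<omega>) = (\<Sum>A\<in>Pow {1..m}. if A = {k\<in>{1..m}. X k \<omega> > 0} then g A else 0)"
      by (intro sum.cong) (auto simp: Z_eq)
    also have "\<dots> = g {k\<in>{1..m}. X k \<omega> > 0}" by (subst sum.delta) auto
    finally show ?thesis .
  qed
  have int_ind: "integrable M (\<lambda>\<omega>. indicator S (X k \<omega>) :: real)" if "S \<in> sets borel" for S k
    using that by (intro integrable_const_bound[of _ 1]) auto
  have int_Xind: "integrable M (\<lambda>\<omega>. X k \<omega> * indicator S (X k \<omega>))" if "S \<in> sets borel" for S k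
    using that int[of k] by (intro Bochner_Integration.integrable_bound[OF int[of k]]) (auto simp: indicator_def)
  have int_\<xi>: "integrable M (\<lambda>\<omega>. \<xi> (X k \<omega>) * g \<omega>)" if "g \<in> borel_measurable M" "\<And>\<omega>. 0 \<le> g \<omega>" "\<And>\<omega>. g \<omega> \<le> 1" for k and g :: "'a \<Rightarrow> real"
  proof (rule integrable_const_bound[of _ "\<bar>d / p\<bar> + \<bar>d / (1 - p)\<bar>"])
    show "AE \<omega> in M. norm (\<xi> (X k \<omega>) * g \<omega>) \<le> \<bar>d / p\<bar> + \<bar>d / (1 - p)\<bar>"
    proof (rule AE_I2)
      fix \<omega>
      have "\<bar>\<xi> (X k \<omega>)\<bar> * \<bar>g \<omega>\<bar> \<le> (\<bar>d / p\<bar> + \<bar>d / (1 - p)\<bar>) * 1"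
        unfolding \<xi>_def using that by (intro mult_mono abs_sgn_cond_le) (auto simp del: abs_divide)
      then show "norm (\<xi> (X k \<omega>) * g \<omega>) \<le> \<bar>d / p\<bar> + \<bar>d / (1 - p)\<bar>" by (simp add: abs_mult)
    qed
  qed (use that in measurable)
  have neg: "expectation (\<lambda>\<omega>. X k \<omega> * indicator {..0} (X k \<omega>)) = - d"
    "expectation (\<lambda>\<omega>. indicator {..0} (X k \<omega>)) = 1 - p" for k
  proof -
    have "expectation (\<lambda>\<omega>. X k \<omega> * indicator {..0} (X k \<omega>)) = expectation (\<lambda>\<omega>. X k \<omega> - X k \<omega> * indicator {0<..} (X k \<omega>))"
      by (intro Bochner_Integration.integral_cong) (auto simp: indicator_def)
    also have "\<dots> = - d" using int int_Xind mean0 d by simp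
    finally show "expectation (\<lambda>\<omega>. X k \<omega> * indicator {..0} (X k \<omega>)) = - d" .
    have "expectation (\<lambda>\<omega>. indicator {..0} (X k \<omega>)) = expectation (\<lambda>\<omega>. 1 - indicator {0<..} (X k \<omega>) :: real)"
      by (intro Bochner_Integration.integral_cong) (auto simp: indicator_def)
    also have "\<dots> = 1 - p" using int_ind p by (simp add: prob_space)
    finally show "expectation (\<lambda>\<omega>. indicator {..0} (X k \<omega>)) = 1 - p" .
  qed
  \<comment> \<open>The part of \<open>X k\<close> invisible to the conditioning: it has integral 0
    over every atom.\<close>
  define D where "D k x = (if k \<in> {1..m} then x - \<xi> x else x)" for k x
  have D[measurable]: "D k \<in> borel_measurable borel" for k
    unfolding D_def[abs_def] by (cases "k \<in> {1..m}") auto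
  have int_D: "integrable M (\<lambda>\<omega>. D k (X k \<omega>) * indicator S (X k \<omega>))" if "S \<in> sets borel" for k S
    using that int_Xind[of S k] int_\<xi>[of "\<lambda>\<omega>. indicator S (X k \<omega>)" k] unfolding D_def
    by (cases "k \<in> {1..m}") (auto simp: left_diff_distrib indicator_def)
  have D0: "expectation (\<lambda>\<omega>. D k (X k \<omega>) * indicator (b A k) (X k \<omega>)) = 0" if "k \<in> {1..m}" for k A
  proof -
    have "expectation (\<lambda>\<omega>. D k (X k \<omega>) * indicator (b A k) (X k \<omega>))
       = expectation (\<lambda>\<omega>. X k \<omega> * indicator (b A k) (X k \<omega>) - (if k \<in> A then d / p else - d / (1 - p)) * indicator (b A k) (X k \<omega>))"
      using that by (intro Bochner_Integration.integral_cong) (auto simp: D_def b_def \<xi>_def sgn_cond_def indicator_def)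
    also have "\<dots> = expectation (\<lambda>\<omega>. X k \<omega> * indicator (b A k) (X k \<omega>)) - (if k \<in> A then d / p else - d / (1 - p)) * expectation (\<lambda>\<omega>. indicator (b A k) (X k \<omega>))"
      using int_Xind[OF b_borel] int_ind[OF b_borel] by simp
    also have "\<dots> = 0" using neg[of k] d[of k] p[of k] p01 by (auto simp: b_def)
    finally show ?thesis .
  qed
  have DZ: "integrable M (\<lambda>\<omega>. D l (X l \<omega>) * Z A \<omega>)" "expectation (\<lambda>\<omega>. D l (X l \<omega>) * Z A \<omega>) = 0" for l A
  proof -
    define g where "g k x = (if k = l then D l x else 1) * indicator (if k \<in> {1..m} then b A k else UNIV) x" for k and x :: real
    have g[measurable]: "g k \<in> borel_measurable borel" for k
      unfolding g_def[abs_def] by (cases "k = l") measurable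
    \<comment> \<open>The index \<open>l\<close> may be 0 or exceed \<open>m\<close>; it then joins
      the product with no sign restriction.\<close>
    define I where "I = insert l {1..m}"
    have fin: "finite I" by (simp add: I_def)
    have "indep_vars (\<lambda>_. borel) X I" using indep by (rule indep_vars_subset) simp
    then have ind: "indep_vars (\<lambda>_. borel) (\<lambda>k \<omega>. g k (X k \<omega>)) I"
      by (rule indep_vars_compose2) simp
    have int_g: "integrable M (\<lambda>\<omega>. g k (X k \<omega>))" for k
      unfolding g_def using int_D[of "if k \<in> {1..m} then b A k else UNIV" l] int_ind[of "if k \<in> {1..m} then b A k else UNIV" k]
      by (cases "k = l") auto
    have prod: "(\<Prod>k\<in>I. g k (X k \<omega>)) = D l (X l \<omega>) * Z A \<omega>" for \<omega>
    proof -
      have "(\<Prod>k\<in>I. g k (X k \<omega>)) = (\<Prod>k\<in>I. if k = l then D l (X k \<omega>) else 1) * (\<Prod>k\<in>I. indicator (if k \<in> {1..m} then b A k else UNIV) (X k \<omega>))"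
        unfolding g_def by (rule prod.distrib)
      also have "(\<Prod>k\<in>I. if k = l then D l (X k \<omega>) else 1) = D l (X l \<omega>)"
        by (subst prod.delta) (auto simp: I_def)
      also have "(\<Prod>k\<in>I. indicator (if k \<in> {1..m} then b A k else UNIV) (X k \<omega>)) = Z A \<omega>"
        unfolding Z_def I_def by (rule prod.mono_neutral_cong_right) auto
      finally show ?thesis .
    qed
    show "integrable M (\<lambda>\<omega>. D l (X l \<omega>) * Z A \<omega>)"
      using indep_vars_integrable[OF fin ind int_g] by (simp add: prod)
    have "expectation (\<lambda>\<omega>. D l (X l \<omega>) * Z A \<omega>) = (\<Prod>k\<in>I. expectation (\<lambda>\<omega>. g k (X k \<omega>)))"
      using indep_vars_lebesgue_integral[OF fin ind int_g] by (simp add: prod)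
    also have "expectation (\<lambda>\<omega>. g l (X l \<omega>)) = 0"
      using D0[of l A] mean0[of l] by (cases "l \<in> {1..m}") (auto simp: g_def D_def)
    then have "(\<Prod>k\<in>I. expectation (\<lambda>\<omega>. g k (X k \<omega>))) = 0"
      by (intro prod_zero) (auto simp: I_def)
    finally show "expectation (\<lambda>\<omega>. D l (X l \<omega>) * Z A \<omega>) = 0" .
  qed
  define \<eta> where "\<eta> A k = (if k \<in> A then d / p else - d / (1 - p))" for A and k :: nat
  define V where "V A = (MAX i\<in>J. \<bar>\<Sum>k=1..m. dft m i k * \<eta> A k\<bar>)" for A
  have int_Z: "integrable M (Z A)" for A
    by (rule integrable_const_bound[of _ 1]) (use Z01 in auto)
  have int_RZ: "integrable M (\<lambda>\<omega>. R \<omega> * Z A \<omega>)" for A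
    by (rule Bochner_Integration.integrable_bound[OF int_R]) (use Z01 in \<open>auto simp: abs_mult mult_left_le\<close>)
  have key: "V A * expectation (Z A) \<le> sqrt 3 * expectation (\<lambda>\<omega>. R \<omega> * Z A \<omega>)" if A: "A \<subseteq> {1..m}" for A
  proof -
    have "\<bar>\<Sum>k=1..m. dft m i k * \<eta> A k\<bar> * expectation (Z A) \<le> sqrt 3 * expectation (\<lambda>\<omega>. R \<omega> * Z A \<omega>)" for i
    proof -
      define \<theta> where "\<theta> = 2 * pi * real i / real m"
      have sub: "{1..m} \<subseteq> {..<3*m}" using m by auto
      have c: "trig_coeff m \<theta> k = real m * dft m i k" if "k \<in> {1..m}" for k
        using that by (subst trig_coeff_eq) (auto simp: dft_def \<theta>_def)
      have Dpt: "D k (X k \<omega>) * Z A \<omega> = X k \<omega> * Z A \<omega> - (if k \<in> {1..m} then \<eta> A k else 0) * Z A \<omega>" for k \<omega>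
        using A by (auto simp: D_def Z_eq \<eta>_def \<xi>_def sgn_cond_def)
      have int_XZ: "integrable M (\<lambda>\<omega>. X k \<omega> * Z A \<omega>)" for k
        using Bochner_Integration.integrable_add[OF DZ(1)[of k A] integrable_mult_right[OF int_Z[of A], of "if k \<in> {1..m} then \<eta> A k else 0"]]
        by (simp add: Dpt)
      have XZ: "expectation (\<lambda>\<omega>. X k \<omega> * Z A \<omega>) = (if k \<in> {1..m} then \<eta> A k else 0) * expectation (Z A)" for k
        using DZ(2)[of k A] int_XZ int_Z unfolding Dpt by simp
      have "real m * (\<Sum>k=1..m. dft m i k * \<eta> A k) * expectation (Z A)
          = (\<Sum>k=1..m. trig_coeff m \<theta> k * ((if k \<in> {1..m} then \<eta> A k else 0) * expectation (Z A)))"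
        unfolding sum_distrib_left sum_distrib_right by (intro sum.cong) (auto simp: c)
      also have "\<dots> = (\<Sum>k<3*m. trig_coeff m \<theta> k * ((if k \<in> {1..m} then \<eta> A k else 0) * expectation (Z A)))"
        using sub by (intro sum.mono_neutral_left) auto
      also have "\<dots> = expectation (\<lambda>\<omega>. \<Sum>k<3*m. trig_coeff m \<theta> k * (X k \<omega> * Z A \<omega>))"
        using int_XZ by (simp add: XZ Bochner_Integration.integral_sum)
      also have "(\<lambda>\<omega>. \<Sum>k<3*m. trig_coeff m \<theta> k * (X k \<omega> * Z A \<omega>)) = (\<lambda>\<omega>. (\<Sum>k<3*m. trig_coeff m \<theta> k * X k \<omega>) * Z A \<omega>)"
        by (simp add: sum_distrib_right mult.assoc)
      also have "\<bar>expectation \<dots>\<bar> \<le> expectation (\<lambda>\<omega>. sqrt 3 * real m * (R \<omega> * Z A \<omega>))"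
      proof (rule abs_integral_le)
        fix \<omega>
        have "\<bar>(\<Sum>k<3*m. trig_coeff m \<theta> k * X k \<omega>) * Z A \<omega>\<bar> \<le> sqrt 3 * real m * R \<omega> * Z A \<omega>"
          unfolding abs_mult using Z01 sum_trig_coeff_le_toeplitz_norm[of m \<theta> "\<lambda>k. X k \<omega>"]
          by (intro mult_mono) (auto simp: R_def toeplitz_norm_nonneg)
        then show "\<bar>(\<Sum>k<3*m. trig_coeff m \<theta> k * X k \<omega>) * Z A \<omega>\<bar> \<le> sqrt 3 * real m * (R \<omega> * Z A \<omega>)"
          by (simp add: mult_ac)
      qed (use int_RZ in simp)
      also have "expectation (\<lambda>\<omega>. sqrt 3 * real m * (R \<omega> * Z A \<omega>)) = real m * (sqrt 3 * expectation (\<lambda>\<omega>. R \<omega> * Z A \<omega>))"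
        by simp
      finally have "real m * (\<bar>\<Sum>k=1..m. dft m i k * \<eta> A k\<bar> * \<bar>expectation (Z A)\<bar>) \<le> real m * (sqrt 3 * expectation (\<lambda>\<omega>. R \<omega> * Z A \<omega>))"
        by (simp only: abs_mult abs_of_nat mult.assoc)
      then have "\<bar>\<Sum>k=1..m. dft m i k * \<eta> A k\<bar> * \<bar>expectation (Z A)\<bar> \<le> sqrt 3 * expectation (\<lambda>\<omega>. R \<omega> * Z A \<omega>)"
        using m by (subst (asm) mult_le_cancel_left_pos) auto
      moreover have "expectation (Z A) \<ge> 0" using Z01 by (intro Bochner_Integration.integral_nonneg) auto
      ultimately show ?thesis by simp
    qed
    \<comment> \<open>On an atom the maximum is a fixed number attained at some index in
      \<open>J\<close>, so the bound for each single \<open>i\<close> gives the bound for the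
      maximum.\<close>
    moreover have "V A \<in> (\<lambda>i. \<bar>\<Sum>k=1..m. dft m i k * \<eta> A k\<bar>) ` J"
      unfolding V_def using J by (intro Max_in) auto
    ultimately show ?thesis by auto
  qed
  have "(MAX i\<in>J. \<bar>\<Sum>k=1..m. dft m i k * \<xi> (X k \<omega>)\<bar>) = V {k\<in>{1..m}. X k \<omega> > 0}" for \<omega>
    unfolding V_def by (intro arg_cong[where f = Max] image_cong arg_cong[where f = abs] sum.cong refl)
      (auto simp: \<eta>_def \<xi>_def sgn_cond_def)
  then have "expectation (\<lambda>\<omega>. MAX i\<in>J. \<bar>\<Sum>k=1..m. dft m i k * \<xi> (X k \<omega>)\<bar>) = expectation (\<lambda>\<omega>. \<Sum>A\<in>Pow {1..m}. V A * Z A \<omega>)"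
    by (simp only: Z_sum)
  also have "\<dots> = (\<Sum>A\<in>Pow {1..m}. V A * expectation (Z A))"
    using int_Z by (subst Bochner_Integration.integral_sum) auto
  also have "\<dots> \<le> (\<Sum>A\<in>Pow {1..m}. sqrt 3 * expectation (\<lambda>\<omega>. R \<omega> * Z A \<omega>))"
    using key by (intro sum_mono) auto
  also have "\<dots> = sqrt 3 * expectation (\<lambda>\<omega>. \<Sum>A\<in>Pow {1..m}. R \<omega> * Z A \<omega>)"
    using int_RZ by (subst Bochner_Integration.integral_sum) (auto simp: sum_distrib_left)
  also have "(\<lambda>\<omega>. \<Sum>A\<in>Pow {1..m}. R \<omega> * Z A \<omega>) = R"
    using Z_sum[of "\<lambda>_. R _"] by (intro ext) simp
  finally show ?thesis by (simp add: \<xi>_def R_def)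
qed

section \<open>Lower bound for the expected norm\<close>

locale iid_L2 = prob_space M for M :: "'a measure" +
  fixes X :: "nat \<Rightarrow> 'a \<Rightarrow> real"
  assumes meas[measurable]: "\<And>k. X k \<in> borel_measurable M"
    and indep: "indep_vars (\<lambda>_. borel) X UNIV"
    and ident: "\<And>k. distr M borel (X k) = distr M borel (X 0)"
    and int2: "integrable M (\<lambda>\<omega>. (X 0 \<omega>)\<^sup>2)"
    and mean0: "expectation (X 0) = 0"
    and var_pos: "expectation (\<lambda>\<omega>. (X 0 \<omega>)\<^sup>2) > 0"
begin

section \<open>Transfer of moments between identically distributed variables\<close>

lemma expectation_ident:
  fixes g :: "real \<Rightarrow> real"
  assumes [measurable]: "g \<in> borel_measurable borel"
  shows "expectation (\<lambda>\<omega>. g (X k \<omega>)) = expectation (\<lambda>\<omega>. g (X 0 \<omega>))"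
proof -
  have "expectation (\<lambda>\<omega>. g (X j \<omega>)) = integral\<^sup>L (distr M borel (X j)) g" for j
    by (rule integral_distr[symmetric]) (rule meas assms)+
  then show ?thesis by (simp only: ident[of k])
qed

lemma integrable_ident:
  fixes g :: "real \<Rightarrow> real"
  assumes [measurable]: "g \<in> borel_measurable borel" and "integrable M (\<lambda>\<omega>. g (X 0 \<omega>))"
  shows "integrable M (\<lambda>\<omega>. g (X k \<omega>))"
proof -
  have "integrable M (\<lambda>\<omega>. g (X j \<omega>)) \<longleftrightarrow> integrable (distr M borel (X j)) g" for j
    by (rule integrable_distr_eq[symmetric]) (rule meas assms)+
  then show ?thesis using assms(2) by (simp only: ident[of k])
qed

lemma integrable_X: "integrable M (X k)"
  using integrable_ident[of "\<lambda>x. x" k, OF _ square_integrable_imp_integrable[OF meas int2]] by measurable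

lemma integrable_X2: "integrable M (\<lambda>\<omega>. (X k \<omega>)\<^sup>2)"
  using integrable_ident[of "\<lambda>x. x\<^sup>2" k, OF _ int2] by measurable

section \<open>The expected norm: integrability, monotonicity and crude growth\<close>

definition e :: "nat \<Rightarrow> real" where
  "e n = expectation (\<lambda>\<omega>. toeplitz_norm n (\<lambda>k. X k \<omega>))"

lemma integrable_toeplitz_norm: "integrable M (\<lambda>\<omega>. toeplitz_norm n (\<lambda>k. X k \<omega>))"
proof (rule Bochner_Integration.integrable_bound)
  show "integrable M (\<lambda>\<omega>. 2 * (\<Sum>k<n. \<bar>X k \<omega>\<bar>))"
    by (intro integrable_mult_right Bochner_Integration.integrable_sum integrable_abs integrable_X)
  show "(\<lambda>\<omega>. toeplitz_norm n (\<lambda>k. X k \<omega>)) \<in> borel_measurable M"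
    by (rule borel_measurable_toeplitz_norm) (rule meas)
  show "AE \<omega> in M. norm (toeplitz_norm n (\<lambda>k. X k \<omega>)) \<le> norm (2 * (\<Sum>k<n. \<bar>X k \<omega>\<bar>))"
    using toeplitz_norm_le_sum[where n = n] by (simp add: toeplitz_norm_nonneg sum_nonneg)
qed

lemma e_mono: "n \<le> m \<Longrightarrow> e n \<le> e m"
  unfolding e_def by (intro integral_mono integrable_toeplitz_norm toeplitz_norm_mono)

lemma e_nonneg: "e n \<ge> 0"
  unfolding e_def by (intro Bochner_Integration.integral_nonneg toeplitz_norm_nonneg)

text \<open>This linear bound forces indices at which \<open>e\<close> exceeds
  \<open>\<rho> ^ k\<close> to grow at least geometrically in \<open>k\<close>.\<close>

lemma e_le: "e n \<le> 2 * expectation (\<lambda>\<omega>. \<bar>X 0 \<omega>\<bar>) * n"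
proof -
  have "e n \<le> expectation (\<lambda>\<omega>. 2 * (\<Sum>k<n. \<bar>X k \<omega>\<bar>))"
    unfolding e_def
    by (intro integral_mono integrable_toeplitz_norm toeplitz_norm_le_sum integrable_mult_right
        Bochner_Integration.integrable_sum integrable_abs integrable_X)
  also have "\<dots> = 2 * (\<Sum>k<n. expectation (\<lambda>\<omega>. \<bar>X k \<omega>\<bar>))"
    by (subst integral_mult_right_zero, subst Bochner_Integration.integral_sum) (auto intro: integrable_X integrable_abs)
  also have "\<dots> = 2 * (\<Sum>k<n. expectation (\<lambda>\<omega>. \<bar>X 0 \<omega>\<bar>))"
    by (intro arg_cong[where f = "(*) 2"] sum.cong refl expectation_ident) simp
  finally show ?thesis by (simp add: mult_ac)
qed

section \<open>The sign-conditioned variables and their exponential moments\<close>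

definition d :: real where "d = expectation (\<lambda>\<omega>. X 0 \<omega> * indicator {0<..} (X 0 \<omega>))"
definition p :: real where "p = expectation (\<lambda>\<omega>. indicator {0<..} (X 0 \<omega>))"
definition Y :: "nat \<Rightarrow> 'a \<Rightarrow> real" where "Y k \<omega> = sgn_cond d p (X k \<omega>)"
definition s2 :: real where "s2 = expectation (\<lambda>\<omega>. (Y 0 \<omega>)\<^sup>2)"

lemma integrable_indicator_X: "S \<in> sets borel \<Longrightarrow> integrable M (\<lambda>\<omega>. indicator S (X k \<omega>) :: real)"
  by (intro integrable_const_bound[of _ 1]) auto

text \<open>Since the mean is 0, E |X| is twice the expected positive part; if that vanished, X
  would be 0 almost surely, against the positive variance.\<close>

lemma d_pos: "d > 0"
proof -
  have int: "integrable M (\<lambda>\<omega>. X 0 \<omega> * indicator {0<..} (X 0 \<omega>))"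
    by (rule Bochner_Integration.integrable_bound[OF integrable_X[of 0]]) (auto simp: indicator_def)
  have "expectation (\<lambda>\<omega>. \<bar>X 0 \<omega>\<bar>) = expectation (\<lambda>\<omega>. 2 * (X 0 \<omega> * indicator {0<..} (X 0 \<omega>)) - X 0 \<omega>)"
    by (intro Bochner_Integration.integral_cong) (auto simp: indicator_def)
  also have "\<dots> = 2 * d" using int integrable_X[of 0] mean0 by (simp add: d_def)
  finally have 1: "expectation (\<lambda>\<omega>. \<bar>X 0 \<omega>\<bar>) = 2 * d" .
  have "d \<ge> 0" unfolding d_def by (intro Bochner_Integration.integral_nonneg) (auto simp: indicator_def)
  moreover have "d \<noteq> 0"
  proof
    assume "d = 0"
    then have "AE \<omega> in M. \<bar>X 0 \<omega>\<bar> = 0"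
      using 1 integrable_X[of 0] integral_nonneg_eq_0_iff_AE[of M "\<lambda>\<omega>. \<bar>X 0 \<omega>\<bar>"] by simp
    then have "expectation (\<lambda>\<omega>. (X 0 \<omega>)\<^sup>2) = expectation (\<lambda>\<omega>. 0)"
      by (intro integral_cong_AE) auto
    then show False using var_pos by simp
  qed
  ultimately show ?thesis by simp
qed

lemma p_pos: "p > 0"
proof -
  have "p \<ge> 0" unfolding p_def by (intro Bochner_Integration.integral_nonneg) auto
  moreover have "p \<noteq> 0"
  proof
    assume "p = 0"
    then have "AE \<omega> in M. indicator {0<..} (X 0 \<omega>) = (0::real)"
      using integrable_indicator_X[of "{0<..}" 0] integral_nonneg_eq_0_iff_AE[of M "\<lambda>\<omega>. indicator {0<..} (X 0 \<omega>) :: real"]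
      by (simp add: p_def)
    then have "d = expectation (\<lambda>\<omega>. 0)"
      unfolding d_def by (intro integral_cong_AE) auto
    then show False using d_pos by simp
  qed
  ultimately show ?thesis by simp
qed

text \<open>If X were positive almost surely, its positive part would have mean
  \<open>expectation (X 0) = 0\<close>, contradicting \<open>d > 0\<close>.\<close>

lemma p_less_1: "p < 1"
proof -
  have q: "expectation (\<lambda>\<omega>. indicator {..0} (X 0 \<omega>) :: real) = 1 - p"
  proof -
    have "expectation (\<lambda>\<omega>. indicator {..0} (X 0 \<omega>)) = expectation (\<lambda>\<omega>. 1 - indicator {0<..} (X 0 \<omega>) :: real)"
      by (intro Bochner_Integration.integral_cong) (auto simp: indicator_def)
    also have "\<dots> = 1 - p" using integrable_indicator_X by (simp add: p_def prob_space)
    finally show ?thesis .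
  qed
  moreover have "expectation (\<lambda>\<omega>. indicator {..0} (X 0 \<omega>) :: real) \<ge> 0"
    by (intro Bochner_Integration.integral_nonneg) auto
  moreover have "p \<noteq> 1"
  proof
    assume "p = 1"
    then have "AE \<omega> in M. indicator {..0} (X 0 \<omega>) = (0::real)"
      using q integrable_indicator_X[of "{..0}" 0] integral_nonneg_eq_0_iff_AE[of M "\<lambda>\<omega>. indicator {..0} (X 0 \<omega>) :: real"]
      by simp
    then have "d = expectation (X 0)"
      unfolding d_def by (intro integral_cong_AE) (auto simp: indicator_def split: if_splits)
    then show False using d_pos mean0 by simp
  qed
  ultimately show ?thesis by linarith
qed

lemma Y_measurable[measurable]: "Y k \<in> borel_measurable M"
  unfolding Y_def[abs_def] by measurable

lemma Y_bound: "\<bar>Y k \<omega>\<bar> \<le> \<bar>d / p\<bar> + \<bar>d / (1 - p)\<bar>"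
  unfolding Y_def by (rule abs_sgn_cond_le)

lemma Y_mean: "expectation (Y 0) = 0"
proof -
  have "expectation (Y 0) = expectation (\<lambda>\<omega>. (d / p + d / (1 - p)) * indicator {0<..} (X 0 \<omega>) - d / (1 - p))"
    by (intro Bochner_Integration.integral_cong) (auto simp: Y_def sgn_cond_def indicator_def)
  also have "\<dots> = (d / p + d / (1 - p)) * p - d / (1 - p)"
    using integrable_indicator_X by (simp add: p_def prob_space)
  also have "\<dots> = 0" using p_pos p_less_1 by (simp add: field_simps)
  finally show ?thesis .
qed

lemma s2_pos: "s2 > 0"
proof -
  have "s2 \<ge> expectation (\<lambda>\<omega>. (d / p)\<^sup>2 * indicator {0<..} (X 0 \<omega>))"
    unfolding s2_def
  proof (rule integral_mono)
    show "integrable M (\<lambda>\<omega>. (Y 0 \<omega>)\<^sup>2)"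
      by (rule integrable_bounded[of _ "(\<bar>d / p\<bar> + \<bar>d / (1 - p)\<bar>)\<^sup>2"])
         (simp, unfold power_abs, intro power_mono Y_bound abs_ge_zero)
    show "integrable M (\<lambda>\<omega>. (d / p)\<^sup>2 * indicator {0<..} (X 0 \<omega>))"
      by (intro integrable_mult_right integrable_indicator_X) simp
  qed (auto simp: Y_def sgn_cond_def indicator_def)
  also have "expectation (\<lambda>\<omega>. (d / p)\<^sup>2 * indicator {0<..} (X 0 \<omega>)) = (d / p)\<^sup>2 * p"
    by (simp add: p_def)
  finally have "(d / p)\<^sup>2 * p \<le> s2" .
  moreover have "0 < (d / p)\<^sup>2 * p" using d_pos p_pos by simp
  ultimately show ?thesis by linarith
qed

text \<open>Independence turns the exponential moment into a product, so the one-variable exponents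
  add. \<open>C\<close> and \<open>x0\<close> do not depend on \<open>m\<close> or \<open>c\<close>,
  hence serve single forms and sums of two forms alike.\<close>

lemma exp_moment_linear_bounds:
  "\<exists>C\<ge>0. \<exists>x0>0. \<forall>m c. (\<forall>k\<in>{1..m}. \<bar>c k\<bar> \<le> x0) \<longrightarrow>
     exp (s2 / 2 * (\<Sum>k=1..m. (c k)\<^sup>2) - C * (\<Sum>k=1..m. \<bar>c k\<bar> ^ 3)) \<le> expectation (\<lambda>\<omega>. exp (\<Sum>k=1..m. c k * Y k \<omega>)) \<and>
     expectation (\<lambda>\<omega>. exp (\<Sum>k=1..m. c k * Y k \<omega>)) \<le> exp (s2 / 2 * (\<Sum>k=1..m. (c k)\<^sup>2) + C * (\<Sum>k=1..m. \<bar>c k\<bar> ^ 3))"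
proof -
  obtain C x0 where C: "C \<ge> 0" "x0 > 0" and *: "\<And>x. \<bar>x\<bar> \<le> x0 \<Longrightarrow>
     exp (s2 * x\<^sup>2 / 2 - C * \<bar>x\<bar> ^ 3) \<le> expectation (\<lambda>\<omega>. exp (x * Y 0 \<omega>)) \<and>
     expectation (\<lambda>\<omega>. exp (x * Y 0 \<omega>)) \<le> exp (s2 * x\<^sup>2 / 2 + C * \<bar>x\<bar> ^ 3)"
    using exp_moment_bounds[OF Y_measurable Y_bound Y_mean s2_def] by blast
  have "exp (s2 / 2 * (\<Sum>k=1..m. (c k)\<^sup>2) - C * (\<Sum>k=1..m. \<bar>c k\<bar> ^ 3)) \<le> expectation (\<lambda>\<omega>. exp (\<Sum>k=1..m. c k * Y k \<omega>)) \<and>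
     expectation (\<lambda>\<omega>. exp (\<Sum>k=1..m. c k * Y k \<omega>)) \<le> exp (s2 / 2 * (\<Sum>k=1..m. (c k)\<^sup>2) + C * (\<Sum>k=1..m. \<bar>c k\<bar> ^ 3))"
    if c: "\<forall>k\<in>{1..m}. \<bar>c k\<bar> \<le> x0" for m :: nat and c :: "nat \<Rightarrow> real"
  proof -
    have "indep_vars (\<lambda>_. borel) X {1..m}" using indep by (rule indep_vars_subset) simp
    then have ind: "indep_vars (\<lambda>_. borel) (\<lambda>k \<omega>. exp (c k * sgn_cond d p (X k \<omega>))) {1..m}"
      by (rule indep_vars_compose2[where Y = "\<lambda>k x. exp (c k * sgn_cond d p x)"]) measurable
    have int: "integrable M (\<lambda>\<omega>. exp (c k * sgn_cond d p (X k \<omega>)))" for k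
    proof (rule integrable_const_bound[of _ "exp (\<bar>c k\<bar> * (\<bar>d / p\<bar> + \<bar>d / (1 - p)\<bar>))"])
      have "c k * sgn_cond d p (X k \<omega>) \<le> \<bar>c k\<bar> * (\<bar>d / p\<bar> + \<bar>d / (1 - p)\<bar>)" for \<omega>
        by (rule order_trans[OF abs_ge_self], unfold abs_mult, intro mult_left_mono abs_sgn_cond_le) simp
      then show "AE \<omega> in M. norm (exp (c k * sgn_cond d p (X k \<omega>))) \<le> exp (\<bar>c k\<bar> * (\<bar>d / p\<bar> + \<bar>d / (1 - p)\<bar>))"
        by simp
    qed simp
    have "expectation (\<lambda>\<omega>. exp (\<Sum>k=1..m. c k * Y k \<omega>)) = expectation (\<lambda>\<omega>. \<Prod>k=1..m. exp (c k * sgn_cond d p (X k \<omega>)))"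
      by (simp add: Y_def exp_sum)
    also have "\<dots> = (\<Prod>k=1..m. expectation (\<lambda>\<omega>. exp (c k * sgn_cond d p (X k \<omega>))))"
      by (rule indep_vars_lebesgue_integral[OF _ ind int]) simp
    also have "\<dots> = (\<Prod>k=1..m. expectation (\<lambda>\<omega>. exp (c k * Y 0 \<omega>)))"
      unfolding Y_def by (intro prod.cong refl expectation_ident[where g = "\<lambda>x. exp (c _ * sgn_cond d p x)"]) measurable
    finally have E: "expectation (\<lambda>\<omega>. exp (\<Sum>k=1..m. c k * Y k \<omega>)) = (\<Prod>k=1..m. expectation (\<lambda>\<omega>. exp (c k * Y 0 \<omega>)))" .
    have lo: "exp (s2 / 2 * (\<Sum>k=1..m. (c k)\<^sup>2) - C * (\<Sum>k=1..m. \<bar>c k\<bar> ^ 3)) = (\<Prod>k=1..m. exp (s2 * (c k)\<^sup>2 / 2 - C * \<bar>c k\<bar> ^ 3))"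
      by (simp add: exp_sum[symmetric] sum_subtractf sum_distrib_left)
    have up: "exp (s2 / 2 * (\<Sum>k=1..m. (c k)\<^sup>2) + C * (\<Sum>k=1..m. \<bar>c k\<bar> ^ 3)) = (\<Prod>k=1..m. exp (s2 * (c k)\<^sup>2 / 2 + C * \<bar>c k\<bar> ^ 3))"
      by (simp add: exp_sum[symmetric] sum.distrib sum_distrib_left)
    show ?thesis
      unfolding E lo up using * c by (intro conjI prod_mono) (auto intro!: Bochner_Integration.integral_nonneg)
  qed
  then show ?thesis using C by blast
qed

text \<open>The condition \<open>2 * s2 * l\<^sup>2 * m = ln N\<close> balances the second moment.
  Up to cubic errors, E exp (l W i) is sqrt N, the N diagonal terms are N^2 each, and the
  off-diagonal terms, by orthogonality, are N each. Both groups are then of order N^3 = N^2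
  \<alpha>^2. The size \<open>m = 2 * N + 1\<close> ensures \<open>i + j < m\<close> for all
  frequencies used.\<close>

lemma expectation_Max_dft_ge:
  assumes C: "C \<ge> 0"
    and bounds: "\<And>m c. (\<And>k. k \<in> {1..m} \<Longrightarrow> \<bar>c k\<bar> \<le> x0) \<Longrightarrow>
     exp (s2 / 2 * (\<Sum>k=1..m. (c k)\<^sup>2) - C * (\<Sum>k=1..m. \<bar>c k\<bar> ^ 3)) \<le> expectation (\<lambda>\<omega>. exp (\<Sum>k=1..m. c k * Y k \<omega>)) \<and>
     expectation (\<lambda>\<omega>. exp (\<Sum>k=1..m. c k * Y k \<omega>)) \<le> exp (s2 / 2 * (\<Sum>k=1..m. (c k)\<^sup>2) + C * (\<Sum>k=1..m. \<bar>c k\<bar> ^ 3))"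
    and N: "N > 0" "ln (real N) \<ge> 5" and m: "m = 2 * N + 1"
    and l: "l > 0" "4 * l \<le> x0" "2 * s2 * l\<^sup>2 * m = ln (real N)" "80 * C * l ^ 3 * m \<le> 1 / 3"
  shows "ln (real N) / (48 * l) \<le> expectation (\<lambda>\<omega>. MAX i\<in>{1..N}. \<bar>\<Sum>k=1..m. dft m i k * Y k \<omega>\<bar>)"
proof -
  define W where "W i \<omega> = (\<Sum>k=1..m. dft m i k * Y k \<omega>)" for i \<omega>
  \<comment> \<open>The common unit of the cubic errors: coefficients at most 2 l give 8 \<eta>, and
    those of a sum of two forms, at most 4 l, give 64 \<eta>.\<close>
  define \<eta> where "\<eta> = C * l ^ 3 * m"
  have \<eta>: "\<eta> \<ge> 0" "80 * \<eta> \<le> 1 / 3" using C l by (auto simp: \<eta>_def mult.assoc)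
  define \<alpha> where "\<alpha> = exp (ln (real N) / 2 - 8 * \<eta>)"
  have dft2: "\<bar>dft m i k\<bar> \<le> 2" for i k by (simp add: dft_def abs_mult)
  have sq: "(\<Sum>k=1..m. (l * dft m i k)\<^sup>2) = l\<^sup>2 * (2 * m)" if "i \<in> {1..N}" for i
    using sum_dft_prod[of i i m] that m
    by (simp add: power_mult_distrib sum_distrib_left[symmetric] power2_eq_square[of "dft _ _ _"])
  have sq2: "(\<Sum>k=1..m. (l * (dft m i k + dft m j k))\<^sup>2) = l\<^sup>2 * (if i = j then 8 * real m else 4 * real m)"
    if "i \<in> {1..N}" "j \<in> {1..N}" for i j
  proof -
    have "(\<Sum>k=1..m. (l * (dft m i k + dft m j k))\<^sup>2)
       = l\<^sup>2 * ((\<Sum>k=1..m. dft m i k * dft m i k) + 2 * (\<Sum>k=1..m. dft m i k * dft m j k) + (\<Sum>k=1..m. dft m j k * dft m j k))"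
      unfolding sum_distrib_left sum.distrib[symmetric]
      by (intro sum.cong refl) (simp add: power2_eq_square algebra_simps)
    also have "\<dots> = l\<^sup>2 * (if i = j then 8 * real m else 4 * real m)"
      using that m sum_dft_prod[of i i m] sum_dft_prod[of i j m] sum_dft_prod[of j j m]
      by (auto simp del: sum.cl_ivl_Suc)
    finally show ?thesis .
  qed
  have lower: "\<alpha> \<le> expectation (\<lambda>\<omega>. exp (l * W i \<omega>))" if i: "i \<in> {1..N}" for i
  proof -
    have cub: "(\<Sum>k=1..m. \<bar>l * dft m i k\<bar> ^ 3) \<le> 8 * l ^ 3 * m"
    proof -
      have "(\<Sum>k=1..m. \<bar>l * dft m i k\<bar> ^ 3) \<le> (\<Sum>k=1..m. (l * 2) ^ 3)"
        using dft2 l by (intro sum_mono power_mono) (auto simp: abs_mult)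
      then show ?thesis by (simp add: power_mult_distrib mult_ac)
    qed
    have "ln (real N) / 2 - 8 * \<eta> = s2 / 2 * (l\<^sup>2 * (2 * m)) - C * (8 * l ^ 3 * m)"
      using l(3) by (simp add: \<eta>_def mult_ac)
    also have "\<dots> \<le> s2 / 2 * (\<Sum>k=1..m. (l * dft m i k)\<^sup>2) - C * (\<Sum>k=1..m. \<bar>l * dft m i k\<bar> ^ 3)"
      unfolding sq[OF i] using cub C by (intro diff_mono mult_left_mono order_refl)
    finally have "\<alpha> \<le> exp \<dots>" by (simp add: \<alpha>_def)
    also have "\<dots> \<le> expectation (\<lambda>\<omega>. exp (\<Sum>k=1..m. l * dft m i k * Y k \<omega>))"
    proof (rule bounds[THEN conjunct1])
      fix k show "\<bar>l * dft m i k\<bar> \<le> x0"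
        using mult_left_mono[OF dft2[of i k] less_imp_le[OF l(1)]] l unfolding abs_mult by linarith
    qed
    finally show ?thesis by (simp add: W_def sum_distrib_left mult.assoc)
  qed
  have upper1: "expectation (\<lambda>\<omega>. exp (l * (W i \<omega> + W j \<omega>))) \<le> (if i = j then (real N)\<^sup>2 else real N) * exp (64 * \<eta>)"
    if i: "i \<in> {1..N}" and j: "j \<in> {1..N}" for i j
  proof -
    have b4: "\<bar>l * (dft m i k + dft m j k)\<bar> \<le> l * 4" for k
      unfolding abs_mult using dft2[of i k] dft2[of j k] l by (intro mult_mono) auto
    have cub: "(\<Sum>k=1..m. \<bar>l * (dft m i k + dft m j k)\<bar> ^ 3) \<le> 64 * l ^ 3 * m"
    proof -
      have "(\<Sum>k=1..m. \<bar>l * (dft m i k + dft m j k)\<bar> ^ 3) \<le> (\<Sum>k=1..m. (l * 4) ^ 3)"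
        by (intro sum_mono power_mono b4) auto
      then show ?thesis by (simp add: power_mult_distrib mult_ac)
    qed
    have "expectation (\<lambda>\<omega>. exp (l * (W i \<omega> + W j \<omega>))) = expectation (\<lambda>\<omega>. exp (\<Sum>k=1..m. l * (dft m i k + dft m j k) * Y k \<omega>))"
      by (simp add: W_def sum_distrib_left sum.distrib[symmetric] algebra_simps)
    also have "\<dots> \<le> exp (s2 / 2 * (\<Sum>k=1..m. (l * (dft m i k + dft m j k))\<^sup>2) + C * (\<Sum>k=1..m. \<bar>l * (dft m i k + dft m j k)\<bar> ^ 3))"
    proof (rule bounds[THEN conjunct2])
      fix k show "\<bar>l * (dft m i k + dft m j k)\<bar> \<le> x0" using b4[of k] l by simp
    qed
    also have "\<dots> \<le> exp (s2 / 2 * (l\<^sup>2 * (if i = j then 8 * real m else 4 * real m)) + C * (64 * l ^ 3 * m))"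
      unfolding sq2[OF i j] exp_le_cancel_iff using cub C by (intro add_mono mult_left_mono order_refl)
    also have "s2 / 2 * (l\<^sup>2 * (if i = j then 8 * real m else 4 * real m)) = (if i = j then 2 else 1) * ln (real N)"
      unfolding l(3)[symmetric] by (simp add: mult_ac)
    also have "C * (64 * l ^ 3 * m) = 64 * \<eta>" by (simp add: \<eta>_def mult_ac)
    also have "exp ((if i = j then 2 else 1) * ln (real N) + 64 * \<eta>) = (if i = j then (real N)\<^sup>2 else real N) * exp (64 * \<eta>)"
      using N exp_of_nat_mult[of 2 "ln (real N)"] by (simp add: exp_add)
    finally show ?thesis .
  qed
  have \<alpha>2: "\<alpha>\<^sup>2 = real N * exp (- 16 * \<eta>)"
  proof -
    have "\<alpha>\<^sup>2 = exp (ln (real N) + - 16 * \<eta>)"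
      unfolding \<alpha>_def exp_of_nat_mult[symmetric, of 2, simplified] by (simp add: algebra_simps exp_of_nat_mult[symmetric])
    then show ?thesis unfolding exp_add using N by simp
  qed
  have "(\<Sum>i=1..N. \<Sum>j=1..N. expectation (\<lambda>\<omega>. exp (l * (W i \<omega> + W j \<omega>))))
      \<le> (\<Sum>i=1..N. \<Sum>j=1..N. ((if i = j then (real N)\<^sup>2 else 0) + real N) * exp (64 * \<eta>))"
  proof (intro sum_mono)
    fix i j assume "i \<in> {1..N}" "j \<in> {1..N}"
    from upper1[OF this] show "expectation (\<lambda>\<omega>. exp (l * (W i \<omega> + W j \<omega>))) \<le> ((if i = j then (real N)\<^sup>2 else 0) + real N) * exp (64 * \<eta>)"
      by (rule order_trans) (intro mult_right_mono, auto)
  qed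
  also have "\<dots> = 2 * real N ^ 3 * exp (64 * \<eta>)"
    by (simp add: sum_distrib_right[symmetric] sum.distrib power2_eq_square power3_eq_cube)
  also have "\<dots> \<le> 3 * real N ^ 3 * exp (- 16 * \<eta>)"
  \<comment> \<open>Diagonal and off-diagonal parts contribute 2; raising this to 3 pays for the
    errors. The gap between 64 \<eta> and -16 \<eta> is 80 \<eta>, and exp (-80 \<eta>) \<ge>
    2/3.\<close>
  proof -
    have "1 - 80 * \<eta> \<le> exp (- (80 * \<eta>))" using exp_ge_add_one_self[of "- (80 * \<eta>)"] by simp
    then have "2 / 3 \<le> exp (- (80 * \<eta>))" using \<eta> by simp
    then have "2 * exp (64 * \<eta>) \<le> 3 * exp (- (80 * \<eta>)) * exp (64 * \<eta>)" by simp
    also have "\<dots> = 3 * exp (- 16 * \<eta>)" by (simp add: exp_add[symmetric])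
    finally have "real N ^ 3 * (2 * exp (64 * \<eta>)) \<le> real N ^ 3 * (3 * exp (- 16 * \<eta>))"
      by (rule mult_left_mono) simp
    then show ?thesis by (simp only: mult_ac)
  qed
  also have "\<dots> = 3 * (real (card {1..N}))\<^sup>2 * \<alpha>\<^sup>2"
    unfolding \<alpha>2 by (simp add: power2_eq_square power3_eq_cube)
  finally have upper: "(\<Sum>i\<in>{1..N}. \<Sum>j\<in>{1..N}. expectation (\<lambda>\<omega>. exp (l * (W i \<omega> + W j \<omega>)))) \<le> 3 * (real (card {1..N}))\<^sup>2 * \<alpha>\<^sup>2" .
  \<comment> \<open>As 8 \<eta> \<le> 1/30 and ln 2 \<le> 1, the losses are below a quarter of
    \<open>ln N \<ge> 5\<close>. This quarter and the factor 4 * 3 from the second moment method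
    give the constant 48.\<close>
  have "1 \<le> ln (real N) / 2 - 8 * \<eta>" using N \<eta> by linarith
  then have \<alpha>_ge: "\<alpha> \<ge> 2"
    using exp_ge_add_one_self[of "ln (real N) / 2 - 8 * \<eta>"] unfolding \<alpha>_def by linarith
  have "ln (\<alpha> / 2) = ln (real N) / 2 - 8 * \<eta> - ln 2" by (simp add: ln_div \<alpha>_def)
  moreover have "ln 2 \<le> (1::real)" using ln_le_minus_one[of "2::real"] by simp
  ultimately have "ln (real N) / 4 \<le> ln (\<alpha> / 2)" using N \<eta> by linarith
  then have "ln (real N) / 4 / (4 * 3 * l) \<le> ln (\<alpha> / 2) / (4 * 3 * l)" using l by (intro divide_right_mono) auto
  also have "\<dots> \<le> expectation (\<lambda>\<omega>. MAX i\<in>{1..N}. \<bar>W i \<omega>\<bar>)"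
  proof (rule expectation_Max_ge)
    fix i \<omega>
    have "\<bar>W i \<omega>\<bar> \<le> (\<Sum>k=1..m. 2 * (\<bar>d / p\<bar> + \<bar>d / (1 - p)\<bar>))"
      unfolding W_def by (rule order_trans[OF sum_abs], unfold abs_mult, intro sum_mono mult_mono dft2 Y_bound) auto
    then show "\<bar>W i \<omega>\<bar> \<le> m * (2 * (\<bar>d / p\<bar> + \<bar>d / (1 - p)\<bar>))" by simp
  qed (use N l lower upper \<alpha>_ge in \<open>auto simp: W_def[abs_def]\<close>)
  finally show ?thesis by (simp add: W_def field_simps)
qed

text \<open>Solving the balance condition for \<open>l\<close> gives order sqrt (ln N / N). Hence
  \<open>l\<close> and \<open>l ^ 3 * m\<close> tend to 0, as the expansion requires, while
  \<open>ln N / l\<close> is of order sqrt (N ln N). This treats sizes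
  \<open>3 * (2 * N + 1)\<close>; monotonicity of \<open>e\<close> covers the rest.\<close>

lemma e_lower: "\<exists>c>0. \<forall>\<^sub>F n in sequentially. c * sqrt (real n * ln (real n)) \<le> e n"
proof -
  from exp_moment_linear_bounds obtain C x0 where C: "C \<ge> 0" "x0 > 0" and
    *: "\<forall>m c. (\<forall>k\<in>{1..m}. \<bar>c k\<bar> \<le> x0) \<longrightarrow>
     exp (s2 / 2 * (\<Sum>k=1..m. (c k)\<^sup>2) - C * (\<Sum>k=1..m. \<bar>c k\<bar> ^ 3)) \<le> expectation (\<lambda>\<omega>. exp (\<Sum>k=1..m. c k * Y k \<omega>)) \<and>
     expectation (\<lambda>\<omega>. exp (\<Sum>k=1..m. c k * Y k \<omega>)) \<le> exp (s2 / 2 * (\<Sum>k=1..m. (c k)\<^sup>2) + C * (\<Sum>k=1..m. \<bar>c k\<bar> ^ 3))"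
    by (elim exE conjE)
  note bounds = *[rule_format]
  define l where "l N = sqrt (ln (real N) / (2 * s2 * (2 * real N + 1)))" for N
  have s: "s2 > 0" by (rule s2_pos)
  define \<kappa> where "\<kappa> = sqrt (1 / (2 * s2))"
  have l_eq: "l N = \<kappa> * sqrt (ln (real N) / (2 * real N + 1))" for N
    unfolding l_def \<kappa>_def real_sqrt_mult[symmetric] by simp
  have ev1: "\<forall>\<^sub>F N in sequentially. ln (real N) \<ge> 5" by real_asymp
  have ev2: "\<forall>\<^sub>F N in sequentially. 4 * l N \<le> x0"
  proof -
    have "(\<lambda>N::nat. sqrt (ln (real N) / (2 * real N + 1))) \<longlonglongrightarrow> 0" by real_asymp
    from tendsto_mult_left[OF this, of "4 * \<kappa>"] have "(\<lambda>N. 4 * l N) \<longlonglongrightarrow> 0" by (simp add: l_eq mult_ac)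
    from order_tendstoD(2)[OF this C(2)] show ?thesis by (rule eventually_mono) simp
  qed
  have ev3: "\<forall>\<^sub>F N in sequentially. 80 * C * l N ^ 3 * (2 * real N + 1) \<le> 1 / 3"
  proof -
    have "(\<lambda>N::nat. sqrt (ln (real N) / (2 * real N + 1)) ^ 3 * (2 * real N + 1)) \<longlonglongrightarrow> 0" by real_asymp
    from tendsto_mult_left[OF this, of "80 * C * \<kappa> ^ 3"]
    have "(\<lambda>N. 80 * C * l N ^ 3 * (2 * real N + 1)) \<longlonglongrightarrow> 0"
      unfolding l_eq power_mult_distrib by (simp add: mult_ac)
    then have "\<forall>\<^sub>F N in sequentially. 80 * C * l N ^ 3 * (2 * real N + 1) < 1 / 3"
      by (rule order_tendstoD(2)) simp
    then show ?thesis by (rule eventually_mono) simp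
  qed
  define c where "c = sqrt (2 * s2) / 48 / sqrt 3"
  have c: "c > 0" using s by (simp add: c_def)
  have "\<forall>\<^sub>F N in sequentially. c * sqrt ((2 * real N + 1) * ln (real N)) \<le> e (6 * N + 3)"
    using ev1 ev2 ev3 eventually_gt_at_top[of 0]
  proof eventually_elim
    case (elim N)
    define m where "m = 2 * N + 1"
    have rm: "real m = 2 * real N + 1" by (simp add: m_def)
    have pos: "0 < ln (real N) / (2 * s2 * (2 * real N + 1))"
      using elim(1) s by (intro divide_pos_pos mult_pos_pos; linarith)
    then have l: "l N > 0" by (simp add: l_def)
    have l2: "2 * s2 * (l N)\<^sup>2 * m = ln (real N)"
    proof -
      have "(l N)\<^sup>2 = ln (real N) / (2 * s2 * (2 * real N + 1))"
        unfolding l_def using pos by (intro real_sqrt_pow2) simp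
      moreover have "2 * s2 * (2 * real N + 1) > 0" using s by (intro mult_pos_pos) auto
      ultimately show ?thesis unfolding rm by (simp add: field_simps)
    qed
    have "ln (real N) / (48 * l N) \<le> expectation (\<lambda>\<omega>. MAX i\<in>{1..N}. \<bar>\<Sum>k=1..m. dft m i k * Y k \<omega>\<bar>)"
      using elim l l2 by (intro expectation_Max_dft_ge[OF C(1) bounds]) (auto simp: m_def add.commute)
    also have "\<dots> \<le> sqrt 3 * expectation (\<lambda>\<omega>. toeplitz_norm (3 * m) (\<lambda>k. X k \<omega>))"
      unfolding Y_def
    proof (rule expectation_toeplitz_norm_ge_Max[OF indep integrable_X])
      show "expectation (X k) = 0" for k using expectation_ident[of "\<lambda>x. x" k] mean0 by simp
      show "expectation (\<lambda>\<omega>. X k \<omega> * indicator {0<..} (X k \<omega>)) = d" for k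
        unfolding d_def by (rule expectation_ident[of "\<lambda>x. x * indicator {0<..} x"]) simp
      show "expectation (\<lambda>\<omega>. indicator {0<..} (X k \<omega>)) = p" for k
        unfolding p_def by (rule expectation_ident) simp
    qed (use elim p_pos p_less_1 in \<open>auto simp: m_def\<close>)
    also have "\<dots> = sqrt 3 * e (6 * N + 3)"
      by (simp add: e_def m_def algebra_simps)
    finally have *: "ln (real N) / (48 * l N) / sqrt 3 \<le> e (6 * N + 3)"
      using pos_divide_le_eq[of "sqrt 3"] by (simp add: mult.commute del: divide_divide_eq_left)
    have "ln (real N) / l N = sqrt (2 * s2) * sqrt ((2 * real N + 1) * ln (real N))"
    proof -
      have "ln (real N) = sqrt (ln (real N)) * sqrt (ln (real N))" using elim by simp
      then have "ln (real N) / l N = (sqrt (ln (real N)) * sqrt (ln (real N))) / (sqrt (ln (real N)) / sqrt (2 * s2 * (2 * real N + 1)))"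
        unfolding l_def real_sqrt_divide by simp
      also have "\<dots> = sqrt (ln (real N)) * sqrt (2 * s2 * (2 * real N + 1))"
      proof -
        have "y * y / (y / z) = y * z" if "y \<noteq> 0" for y z :: real using that by (cases "z = 0") auto
        moreover have "sqrt (ln (real N)) \<noteq> 0" using elim(1) by simp
        ultimately show ?thesis by blast
      qed
      finally show ?thesis by (simp add: real_sqrt_mult mult_ac)
    qed
    then have "ln (real N) / (48 * l N) / sqrt 3 = c * sqrt ((2 * real N + 1) * ln (real N))"
      by (simp add: c_def field_simps)
    then show ?case using * by simp
  qed
  then have "\<forall>\<^sub>F n in sequentially. c * sqrt ((2 * real (n div 6 - 1) + 1) * ln (real (n div 6 - 1))) \<le> e (6 * (n div 6 - 1) + 3)"
  proof (rule eventually_compose_filterlim)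
    show "filterlim (\<lambda>n::nat. n div 6 - 1) at_top sequentially"
      unfolding filterlim_at_top eventually_sequentially
    proof
      fix Z :: nat show "\<exists>N. \<forall>n\<ge>N. Z \<le> n div 6 - 1" by (rule exI[of _ "6 * (Z + 1)"]) auto
    qed
  qed
  then have "\<forall>\<^sub>F n in sequentially. c / 5 * sqrt (real n * ln (real n)) \<le> e n"
    using eventually_ge_at_top[of 200]
  proof eventually_elim
    case (elim n)
    \<comment> \<open>Subtracting 1 leaves room for the 3 in \<open>6 * N + 3 \<le> n\<close>, which
      \<open>n div 6\<close> alone would not guarantee.\<close>
    define N where "N = n div 6 - 1"
    have "n \<le> 6 * N + 11" "6 * N + 3 \<le> n" using elim by (auto simp: N_def)
    then have N: "real n \<le> 12 * real N" using elim by linarith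
    have "N > 0" using elim(2) N by simp
    have "(real N)\<^sup>2 \<ge> (real n / 12)\<^sup>2" using N by (intro power_mono) auto
    also have "(real n / 12)\<^sup>2 \<ge> real n" using elim by (simp add: power2_eq_square field_simps)
    finally have "ln (real n) \<le> ln ((real N)\<^sup>2)" using elim(2) \<open>N > 0\<close> by (subst ln_le_cancel_iff) auto
    also have "\<dots> = 2 * ln (real N)" using N elim by (simp add: ln_realpow)
    finally have ln: "ln (real n) / 2 \<le> ln (real N)" by simp
    \<comment> \<open>The losses 12 from \<open>N\<close> against \<open>n\<close> and 2 from the
      logarithm multiply to 24, rounded up to the square 25.\<close>
    have "c / 5 * sqrt (real n * ln (real n)) = c * sqrt (real n / 12 * (ln (real n) / 2) * (24 / 25))"
      using real_sqrt_divide[of "real n * ln (real n)" 25] by simp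
    also have "\<dots> \<le> c * sqrt ((2 * real N + 1) * ln (real N))"
    proof (intro mult_left_mono real_sqrt_le_mono)
      have "real n / 12 * (ln (real n) / 2) * (24 / 25) \<le> real n / 12 * (ln (real n) / 2)" using elim by simp
      also have "\<dots> \<le> (2 * real N + 1) * ln (real N)" using N ln elim by (intro mult_mono) auto
      finally show "real n / 12 * (ln (real n) / 2) * (24 / 25) \<le> (2 * real N + 1) * ln (real N)" .
    qed (use c in auto)
    also have "\<dots> \<le> e (6 * N + 3)" using elim by (simp add: N_def)
    also have "\<dots> \<le> e n" using \<open>6 * N + 3 \<le> n\<close> by (rule e_mono)
    finally show ?case .
  qed
  then show ?thesis using c by (intro exI[of _ "c / 5"]) auto
qed

end

section \<open>The law of large numbers\<close>

lemma (in prob_space) square_expectation_le: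
  fixes g :: "'a \<Rightarrow> real"
  assumes "integrable M g" "integrable M (\<lambda>x. (g x)\<^sup>2)"
  shows "(expectation g)\<^sup>2 \<le> expectation (\<lambda>x. (g x)\<^sup>2)"
  using variance_eq[OF assms] variance_positive[of g] by simp

context iid_L2
begin

section \<open>Truncation at sqrt n and concentration of the truncated norm\<close>

definition trunc :: "nat \<Rightarrow> real \<Rightarrow> real" where
  "trunc n x = (if x\<^sup>2 \<le> real n then x else 0)"

text \<open>The truncated variables are not recentred: \<open>F n\<close> is concentrated around its
  own mean, and that mean is compared with \<open>e n\<close> afterwards.\<close>

definition F :: "nat \<Rightarrow> 'a \<Rightarrow> real" where
  "F n \<omega> = toeplitz_norm n (\<lambda>k. trunc n (X k \<omega>))"

definition v :: real where "v = expectation (\<lambda>\<omega>. (X 0 \<omega>)\<^sup>2)"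

lemma trunc_measurable[measurable]: "trunc n \<in> borel_measurable borel"
  unfolding trunc_def[abs_def] by measurable

lemma abs_trunc_le: "\<bar>trunc n x\<bar> \<le> sqrt (real n)"
  using real_sqrt_le_mono[of "x\<^sup>2" "real n"] by (auto simp: trunc_def)

lemma F_measurable[measurable]: "F n \<in> borel_measurable M"
  unfolding F_def[abs_def] by (rule borel_measurable_toeplitz_norm) measurable

lemma F_bound: "\<bar>F n \<omega>\<bar> \<le> 2 * (n * sqrt n)"
proof -
  have "F n \<omega> \<le> 2 * (\<Sum>k<n. \<bar>trunc n (X k \<omega>)\<bar>)"
    unfolding F_def by (rule toeplitz_norm_le_sum)
  also have "\<dots> \<le> 2 * (\<Sum>k<n. sqrt (real n))"
    by (intro mult_left_mono sum_mono abs_trunc_le) simp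
  finally show ?thesis using toeplitz_norm_nonneg by (simp add: F_def)
qed

text \<open>The martingale bound is used with \<open>h\<close> twice the absolute truncated value.
  Then \<open>q2 \<le> 16 * v\<close>, and \<open>q4 \<le> 256 * n * v\<close> since truncation
  bounds a fourth power by \<open>n\<close> times a square. Both terms are of order n^2, with
  constants 8 * 16^2 and 3 * 256.\<close>

lemma F_fourth_moment: "expectation (\<lambda>\<omega>. (F n \<omega> - expectation (F n)) ^ 4) \<le> (2048 * v\<^sup>2 + 768 * v) * (real n)\<^sup>2"
proof (cases "n = 0")
  case True
  then have "F n = (\<lambda>_. 0)" using F_bound[of n] by auto
  then show ?thesis using True by simp
next
  case False
  define N where "N = distr M borel (X 0)"
  interpret N: prob_space N unfolding N_def by (rule prob_space_distr) (rule meas)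
  have sets_N[measurable_cong]: "sets N = sets borel" by (simp add: N_def)
  have space_N: "space N = UNIV" by (simp add: N_def)
  define P where "P = PiM {..<n} (\<lambda>_. N)"
  define r where "r \<omega> = (\<lambda>i\<in>{..<n}. X i \<omega>)" for \<omega>
  \<comment> \<open>Independence identifies the joint law with a product measure, so the bound on
    the product space transfers. The index set is nonempty because \<open>n = 0\<close> was split
    off.\<close>
  have "indep_vars (\<lambda>_. borel) X {..<n}" using indep by (rule indep_vars_subset) simp
  then have "distr M (PiM {..<n} (\<lambda>_. borel)) r = PiM {..<n} (\<lambda>i. distr M borel (X i))"
    using False unfolding r_def[abs_def] by (subst (asm) indep_vars_iff_distr_eq_PiM) auto
  also have "\<dots> = P" unfolding P_def N_def by (intro PiM_cong refl ident)
  finally have P_eq: "P = distr M (PiM {..<n} (\<lambda>_. borel)) r" ..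
  have r_meas: "r \<in> M \<rightarrow>\<^sub>M PiM {..<n} (\<lambda>_. borel)"
    unfolding r_def[abs_def] by measurable
  \<comment> \<open>Points of the product space are \<open>undefined\<close> beyond
    \<open>n\<close>; these coordinates are set to 0, which the norm does not see.\<close>
  define f where "f x = toeplitz_norm n (\<lambda>k. if k < n then trunc n (x k) else 0)" for x
  have f_borel: "f \<in> borel_measurable (PiM {..<n} (\<lambda>_. borel))"
    unfolding f_def[abs_def]
  proof (rule borel_measurable_toeplitz_norm)
    fix k show "(\<lambda>x. if k < n then trunc n (x k) else 0) \<in> borel_measurable (PiM {..<n} (\<lambda>_. borel))"
      by (cases "k < n") auto
  qed
  have fr: "f (r \<omega>) = F n \<omega>" for \<omega>
    unfolding f_def F_def r_def by (rule toeplitz_norm_cong) simp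
  have tr: "(\<integral>x. g (f x) \<partial>P) = expectation (\<lambda>\<omega>. g (F n \<omega>))" if "g \<in> borel_measurable borel" for g :: "real \<Rightarrow> real"
    unfolding P_eq using that f_borel r_meas by (subst integral_distr) (auto simp: fr)
  define h where "h x = 2 * \<bar>trunc n x\<bar>" for x
  have h_meas: "h \<in> borel_measurable borel" unfolding h_def[abs_def] by measurable
  have [measurable]: "h \<in> borel_measurable N" unfolding h_def[abs_def] by measurable
  have h_le: "\<bar>h x\<bar> \<le> 2 * sqrt n" for x unfolding h_def using abs_trunc_le[of n x] by simp
  have int_h: "integrable N (\<lambda>x. h x ^ k)" for k
    by (rule N.integrable_bounded[of _ "(2 * sqrt n) ^ k"], measurable) (unfold power_abs, intro power_mono h_le abs_ge_zero)
  define a where "a = (\<integral>x. h x \<partial>N)"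
  define G where "G u = h u + a" for u
  have int_G: "integrable N (\<lambda>x. G x ^ k)" for k
    unfolding G_def
  proof (rule N.integrable_bounded[of _ "(2 * sqrt n + \<bar>a\<bar>) ^ k"])
    fix x show "\<bar>(h x + a) ^ k\<bar> \<le> (2 * sqrt n + \<bar>a\<bar>) ^ k"
      unfolding power_abs using h_le[of x] by (intro power_mono) auto
  qed measurable
  have tr_h: "(\<integral>x. h x ^ k \<partial>N) = expectation (\<lambda>\<omega>. h (X 0 \<omega>) ^ k)" for k
    unfolding N_def by (rule integral_distr) (use h_meas in measurable)
  have int_hX: "integrable M (\<lambda>\<omega>. h (X 0 \<omega>) ^ k)" for k
    using int_h[of k] unfolding N_def by (subst (asm) integrable_distr_eq) (use h_meas in measurable)
  have h_sq: "(h x)\<^sup>2 \<le> 4 * x\<^sup>2" for x by (simp add: h_def trunc_def power_mult_distrib)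
  have h_4: "(h x) ^ 4 \<le> 16 * real n * x\<^sup>2" for x
  proof -
    have "(h x)\<^sup>2 \<le> (2 * sqrt n)\<^sup>2"
      using power_mono[OF h_le abs_ge_zero, of x 2] by simp
    then have "(h x)\<^sup>2 * (h x)\<^sup>2 \<le> (4 * real n) * (4 * x\<^sup>2)"
      using h_sq[of x] by (intro mult_mono) (auto simp: power_mult_distrib)
    then show ?thesis by (simp add: power2_eq_square power4_eq_xxxx)
  qed
  have h2: "(\<integral>x. (h x)\<^sup>2 \<partial>N) \<le> 4 * v"
  proof -
    have "(\<integral>x. (h x)\<^sup>2 \<partial>N) \<le> expectation (\<lambda>\<omega>. 4 * (X 0 \<omega>)\<^sup>2)"
      unfolding tr_h using int_hX int2 h_sq by (intro integral_mono) auto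
    then show ?thesis by (simp add: v_def)
  qed
  have h4: "(\<integral>x. h x ^ 4 \<partial>N) \<le> 16 * n * v"
  proof -
    have "(\<integral>x. h x ^ 4 \<partial>N) \<le> expectation (\<lambda>\<omega>. 16 * real n * (X 0 \<omega>)\<^sup>2)"
      unfolding tr_h using int_hX int2 h_4 by (intro integral_mono) auto
    then show ?thesis by (simp add: v_def)
  qed
  have a2: "a\<^sup>2 \<le> (\<integral>x. (h x)\<^sup>2 \<partial>N)"
    unfolding a_def using int_h[of 1] int_h[of 2] by (intro N.square_expectation_le) auto
  have "(a\<^sup>2)\<^sup>2 \<le> (\<integral>x. (h x)\<^sup>2 \<partial>N)\<^sup>2" using a2 by (intro power_mono) auto
  also have "\<dots> \<le> (\<integral>x. ((h x)\<^sup>2)\<^sup>2 \<partial>N)"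
    using int_h[of 2] int_h[of 4] by (intro N.square_expectation_le) auto
  finally have a4: "a ^ 4 \<le> (\<integral>x. h x ^ 4 \<partial>N)" by simp
  have sq: "(s + t)\<^sup>2 \<le> 2 * s\<^sup>2 + 2 * t\<^sup>2" for s t :: real
    using zero_le_power2[of "s - t"] by (simp add: power2_eq_square algebra_simps)
  have qu: "(s + t) ^ 4 \<le> 8 * s ^ 4 + 8 * t ^ 4" for s t :: real
  proof -
    have "((s + t)\<^sup>2)\<^sup>2 \<le> (2 * s\<^sup>2 + 2 * t\<^sup>2)\<^sup>2" using sq by (intro power_mono) auto
    also have "\<dots> \<le> 2 * (2 * s\<^sup>2)\<^sup>2 + 2 * (2 * t\<^sup>2)\<^sup>2" by (rule sq)
    finally show ?thesis by (simp add: power_mult_distrib)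
  qed
  define q2 q4 where "q2 = (\<integral>u. (G u)\<^sup>2 \<partial>N)" and "q4 = (\<integral>u. (G u) ^ 4 \<partial>N)"
  have "q2 \<le> (\<integral>u. 2 * (h u)\<^sup>2 + 2 * a\<^sup>2 \<partial>N)"
    unfolding q2_def using int_G int_h by (intro integral_mono) (auto simp: G_def sq)
  also have "\<dots> = 2 * (\<integral>u. (h u)\<^sup>2 \<partial>N) + 2 * a\<^sup>2" using int_h by (simp add: N.prob_space)
  finally have q2: "q2 \<le> 16 * v" using a2 h2 by linarith
  have "q4 \<le> (\<integral>u. 8 * (h u) ^ 4 + 8 * a ^ 4 \<partial>N)"
    unfolding q4_def using int_G int_h by (intro integral_mono) (auto simp: G_def qu)
  also have "\<dots> = 8 * (\<integral>u. (h u) ^ 4 \<partial>N) + 8 * a ^ 4" using int_h by (simp add: N.prob_space)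
  finally have q4: "q4 \<le> 256 * real n * v" using a4 h4 by linarith
  have q2_0: "q2 \<ge> 0" by (simp add: q2_def)
  have "(\<integral>x. (f x - (\<integral>x. f x \<partial>P)) ^ 4 \<partial>P) \<le> 8 * (real n)\<^sup>2 * q2\<^sup>2 + 3 * real n * q4"
    unfolding P_def
  proof (rule product_fourth_moment_bound[THEN conjunct2])
    show "prob_space N" by (rule N.prob_space_axioms)
    show "\<bar>h u\<bar> \<le> 2 * sqrt n" for u by (rule h_le)
    show "f \<in> borel_measurable (PiM {..<n} (\<lambda>_. N))"
      using f_borel sets_N by (simp cong: measurable_cong_sets sets_PiM_cong)
    show "\<bar>f x\<bar> \<le> 2 * (n * sqrt n)" for x
    proof -
      have "f x \<le> 2 * (\<Sum>k<n. \<bar>if k < n then trunc n (x k) else 0\<bar>)"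
        unfolding f_def by (rule toeplitz_norm_le_sum)
      also have "\<dots> \<le> 2 * (\<Sum>k<n. sqrt (real n))"
        by (intro mult_left_mono sum_mono) (auto simp: abs_trunc_le)
      finally show ?thesis using toeplitz_norm_nonneg by (simp add: f_def)
    qed
    show "\<bar>f x - f (x(j := w))\<bar> \<le> h (x j) + h w" if j: "j < n" for x j w
    proof -
      have "\<bar>f x - f (x(j := w))\<bar> \<le> 2 * (\<Sum>k<n. \<bar>(if k < n then trunc n (x k) else 0) - (if k < n then trunc n ((x(j := w)) k) else 0)\<bar>)"
        unfolding f_def by (rule abs_toeplitz_norm_diff_le)
      also have "(\<Sum>k<n. \<bar>(if k < n then trunc n (x k) else 0) - (if k < n then trunc n ((x(j := w)) k) else 0)\<bar>)
         = (\<Sum>k<n. if k = j then \<bar>trunc n (x j) - trunc n w\<bar> else 0)"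
        by (intro sum.cong) auto
      also have "\<dots> = \<bar>trunc n (x j) - trunc n w\<bar>" using j by simp
      also have "2 * \<bar>trunc n (x j) - trunc n w\<bar> \<le> 2 * (\<bar>trunc n (x j)\<bar> + \<bar>trunc n w\<bar>)"
        by (intro mult_left_mono abs_triangle_ineq4) simp
      finally show ?thesis by (simp add: h_def fun_upd_def)
    qed
  qed (auto simp: G_def[abs_def] a_def q2_def q4_def)
  also have "\<dots> \<le> 8 * (real n)\<^sup>2 * (16 * v)\<^sup>2 + 3 * real n * (256 * real n * v)"
    using q2 q4 q2_0 by (intro add_mono mult_left_mono power_mono) auto
  also have "\<dots> = (2048 * v\<^sup>2 + 768 * v) * (real n)\<^sup>2"
    by (simp add: power2_eq_square algebra_simps)
  finally show ?thesis
    using tr[of "\<lambda>y. (y - (\<integral>x. f x \<partial>P)) ^ 4"] tr[of "\<lambda>y. y"] by simp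
qed

lemma integrable_F: "integrable M (F n)"
  by (rule integrable_bounded[OF F_measurable F_bound])

text \<open>Truncation removes only values with |x| > sqrt n, where |x| \<le> x^2 / sqrt n. Summed
  over \<open>n\<close> variables, with the Lipschitz factor 2, this costs 2 v sqrt n.\<close>

lemma abs_expectation_F_minus_e_le: "\<bar>expectation (F n) - e n\<bar> \<le> 2 * v * sqrt n"
proof (cases "n = 0")
  case False
  have pt: "\<bar>trunc n x - x\<bar> \<le> x\<^sup>2 / sqrt n" for x
  proof (cases "x\<^sup>2 \<le> real n")
    case nle: False
    then have "sqrt n \<le> \<bar>x\<bar>" using real_sqrt_le_mono[of n "x\<^sup>2"] by simp
    then have "\<bar>x\<bar> * sqrt n \<le> \<bar>x\<bar> * \<bar>x\<bar>" by (intro mult_left_mono) auto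
    then show ?thesis using nle False by (simp add: trunc_def field_simps power2_eq_square)
  qed (simp add: trunc_def)
  have "\<bar>expectation (F n) - e n\<bar> = \<bar>expectation (\<lambda>\<omega>. F n \<omega> - toeplitz_norm n (\<lambda>k. X k \<omega>))\<bar>"
    unfolding e_def using integrable_F integrable_toeplitz_norm by simp
  also have "\<dots> \<le> expectation (\<lambda>\<omega>. 2 * (\<Sum>k<n. (X k \<omega>)\<^sup>2 / sqrt n))"
  proof (rule abs_integral_le)
    fix \<omega>
    have "\<bar>F n \<omega> - toeplitz_norm n (\<lambda>k. X k \<omega>)\<bar> \<le> 2 * (\<Sum>k<n. \<bar>trunc n (X k \<omega>) - X k \<omega>\<bar>)"
      unfolding F_def by (rule abs_toeplitz_norm_diff_le)
    also have "\<dots> \<le> 2 * (\<Sum>k<n. (X k \<omega>)\<^sup>2 / sqrt n)"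
      by (intro mult_left_mono sum_mono pt) simp
    finally show "\<bar>F n \<omega> - toeplitz_norm n (\<lambda>k. X k \<omega>)\<bar> \<le> 2 * (\<Sum>k<n. (X k \<omega>)\<^sup>2 / sqrt n)" .
  qed (intro integrable_mult_right Bochner_Integration.integrable_sum integrable_divide integrable_X2)
  also have "\<dots> = 2 * (\<Sum>k<n. expectation (\<lambda>\<omega>. (X k \<omega>)\<^sup>2 / sqrt n))"
    by (subst integral_mult_right_zero, subst Bochner_Integration.integral_sum) (auto intro: integrable_X2)
  also have "\<dots> = 2 * (\<Sum>k<n. v / sqrt n)"
  proof (intro arg_cong[where f = "(*) 2"] sum.cong refl)
    fix k
    have "expectation (\<lambda>\<omega>. (X k \<omega>)\<^sup>2 / sqrt n) = expectation (\<lambda>\<omega>. (X 0 \<omega>)\<^sup>2 / sqrt n)"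
      by (rule expectation_ident[where g = "\<lambda>x. x\<^sup>2 / sqrt n"]) measurable
    then show "expectation (\<lambda>\<omega>. (X k \<omega>)\<^sup>2 / sqrt n) = v / sqrt n" by (simp add: v_def)
  qed
  also have "\<dots> = 2 * v * (real n / sqrt n)" by simp
  also have "real n / sqrt n = sqrt n" by (rule real_div_sqrt) simp
  finally show ?thesis .
next
  case True
  then have "F n = (\<lambda>_. 0)" using F_bound[of n] by auto
  then show ?thesis using True e_nonneg[of n] e_le[of n] by simp
qed

lemma prob_F_deviation:
  assumes "\<epsilon> > 0"
  shows "\<exists>C. \<forall>\<^sub>F n in sequentially. prob {\<omega>\<in>space M. \<bar>F n \<omega> - e n\<bar> \<ge> \<epsilon> * e n} \<le> C / (ln (real n))\<^sup>2"
proof -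
  obtain c where c: "c > 0" and low: "\<forall>\<^sub>F n in sequentially. c * sqrt (real n * ln (real n)) \<le> e n"
    using e_lower by blast
  define K where "K = 2048 * v\<^sup>2 + 768 * v"
  have v: "v \<ge> 0" by (simp add: v_def)
  then have K: "K \<ge> 0" by (simp add: K_def)
  have "(\<lambda>n::nat. 1 / sqrt (ln (real n))) \<longlonglongrightarrow> 0" by real_asymp
  from tendsto_mult_left[OF this, of "2 * v"] have "(\<lambda>n::nat. 2 * v / sqrt (ln (real n))) \<longlonglongrightarrow> 0" by simp
  then have ev: "\<forall>\<^sub>F n::nat in sequentially. 2 * v / sqrt (ln (real n)) < \<epsilon> / 2 * c"
    by (rule order_tendstoD(2)) (use assms c in simp)
  have "\<forall>\<^sub>F n in sequentially. prob {\<omega>\<in>space M. \<bar>F n \<omega> - e n\<bar> \<ge> \<epsilon> * e n} \<le> (16 * K / (\<epsilon> * c) ^ 4) / (ln (real n))\<^sup>2"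
    using low ev eventually_ge_at_top[of 2]
  proof eventually_elim
    case (elim n)
    have ln: "ln (real n) > 0" using elim by simp
    \<comment> \<open>Half of the allowed deviation absorbs the bias of the mean; the other half is
      left for Markov's inequality.\<close>
    define t where "t = \<epsilon> / 2 * (c * sqrt (real n * ln (real n)))"
    have t: "t > 0" using assms c ln elim by (simp add: t_def)
    have "2 * v \<le> \<epsilon> / 2 * c * sqrt (ln (real n))" using elim(2) ln by (simp add: divide_less_eq)
    then have "2 * v * sqrt n \<le> \<epsilon> / 2 * c * sqrt (ln (real n)) * sqrt n" by (rule mult_right_mono) simp
    also have "\<dots> = t" by (simp add: t_def real_sqrt_mult)
    finally have bias: "\<bar>expectation (F n) - e n\<bar> \<le> t"
      using abs_expectation_F_minus_e_le[of n] by linarith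
    have te: "2 * t \<le> \<epsilon> * e n" using mult_left_mono[OF elim(1), of \<epsilon>] assms by (simp add: t_def)
    have int4: "integrable M (\<lambda>\<omega>. (F n \<omega> - expectation (F n)) ^ 4)"
    proof (rule integrable_bounded[of _ "(2 * (n * sqrt n) + \<bar>expectation (F n)\<bar>) ^ 4"])
      fix \<omega> show "\<bar>(F n \<omega> - expectation (F n)) ^ 4\<bar> \<le> (2 * (n * sqrt n) + \<bar>expectation (F n)\<bar>) ^ 4"
        unfolding power_abs using F_bound[of n \<omega>] by (intro power_mono) auto
    qed measurable
    have "prob {\<omega>\<in>space M. \<bar>F n \<omega> - e n\<bar> \<ge> \<epsilon> * e n} \<le> prob {\<omega>\<in>space M. (F n \<omega> - expectation (F n)) ^ 4 \<ge> t ^ 4}"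
    proof (rule finite_measure_mono)
      show "{\<omega>\<in>space M. \<bar>F n \<omega> - e n\<bar> \<ge> \<epsilon> * e n} \<subseteq> {\<omega>\<in>space M. (F n \<omega> - expectation (F n)) ^ 4 \<ge> t ^ 4}"
      proof clarify
        fix \<omega> assume "\<epsilon> * e n \<le> \<bar>F n \<omega> - e n\<bar>"
        then have "t \<le> \<bar>F n \<omega> - expectation (F n)\<bar>" using bias te by linarith
        then have "t ^ 4 \<le> \<bar>F n \<omega> - expectation (F n)\<bar> ^ 4" using t by (intro power_mono) auto
        then show "t ^ 4 \<le> (F n \<omega> - expectation (F n)) ^ 4" by simp
      qed
    qed measurable
    also have "\<dots> \<le> expectation (\<lambda>\<omega>. (F n \<omega> - expectation (F n)) ^ 4) / t ^ 4"
      using t int4 by (intro integral_Markov_inequality_measure[where A = "{}"]) auto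
    also have "\<dots> \<le> K * (real n)\<^sup>2 / t ^ 4"
      using F_fourth_moment[of n] t by (intro divide_right_mono) (auto simp: K_def)
    also have "t ^ 4 = (\<epsilon> * c) ^ 4 / 16 * ((real n)\<^sup>2 * (ln (real n))\<^sup>2)"
    proof -
      have "sqrt (real n * ln (real n)) ^ 4 = ((sqrt (real n * ln (real n)))\<^sup>2)\<^sup>2" by simp
      also have "\<dots> = (real n * ln (real n))\<^sup>2" using ln by (subst real_sqrt_pow2) auto
      finally show ?thesis by (simp add: t_def power_mult_distrib power_divide)
    qed
    also have "K * (real n)\<^sup>2 / ((\<epsilon> * c) ^ 4 / 16 * ((real n)\<^sup>2 * (ln (real n))\<^sup>2)) = (16 * K / (\<epsilon> * c) ^ 4) / (ln (real n))\<^sup>2"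
      using elim assms c ln by (simp add: field_simps)
    finally show ?case .
  qed
  then show ?thesis by blast
qed

text \<open>Borel-Cantelli is applied to \<open>(X k)^2 > k\<close>, with the level tied to the
  index of the variable rather than to the matrix size. Each variable is thus tested once, and the
  probabilities sum to at most \<open>v + 1\<close>.\<close>

lemma AE_eventually_F_eq:
  "AE \<omega> in M. \<forall>\<^sub>F n in sequentially. F n \<omega> = toeplitz_norm n (\<lambda>k. X k \<omega>)"
proof -
  define A where "A k = {\<omega>\<in>space M. (X k \<omega>)\<^sup>2 > real k}" for k
  have A[measurable]: "A k \<in> sets M" for k unfolding A_def by measurable
  have A_eq: "prob (A k) = expectation (\<lambda>\<omega>. indicator {real k<..} ((X 0 \<omega>)\<^sup>2))" for k
  proof -
    have "prob (A k) = expectation (indicator (A k))" by simp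
    also have "\<dots> = expectation (\<lambda>\<omega>. indicator {real k<..} ((X k \<omega>)\<^sup>2))"
      by (intro Bochner_Integration.integral_cong) (auto simp: A_def indicator_def)
    also have "\<dots> = expectation (\<lambda>\<omega>. indicator {real k<..} ((X 0 \<omega>)\<^sup>2))"
      by (rule expectation_ident[where g = "\<lambda>x. indicator {real k<..} (x\<^sup>2)"]) measurable
    finally show ?thesis .
  qed
  have count: "(\<Sum>k<n. indicator {real k<..} y :: real) \<le> y + 1" if "y \<ge> 0" for y :: real and n :: nat
  proof -
    have "(\<Sum>k<n. indicator {real k<..} y :: real) = real (card {k\<in>{..<n}. real k < y})"
      by (simp add: indicator_def sum.If_cases Int_def)
    also have "{k\<in>{..<n}. real k < y} \<subseteq> {..<nat \<lceil>y\<rceil>}" by (auto simp: less_ceiling_iff zless_nat_eq_int_zless)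
    then have "card {k\<in>{..<n}. real k < y} \<le> card {..<nat \<lceil>y\<rceil>}" by (intro card_mono) auto
    then have "real (card {k\<in>{..<n}. real k < y}) \<le> real (nat \<lceil>y\<rceil>)" by simp
    also have "\<dots> \<le> y + 1" using that by linarith
    finally show ?thesis .
  qed
  have int_i: "integrable M (\<lambda>\<omega>. indicator {real k<..} ((X 0 \<omega>)\<^sup>2) :: real)" for k
    by (rule integrable_const_bound[of _ 1]) auto
  have "summable (\<lambda>k. prob (A k))"
  proof (rule bounded_imp_summable)
    fix n
    have "(\<Sum>k\<le>n. prob (A k)) = expectation (\<lambda>\<omega>. \<Sum>k<Suc n. indicator {real k<..} ((X 0 \<omega>)\<^sup>2))"
      using int_i by (simp add: A_eq lessThan_Suc_atMost)
    also have "\<dots> \<le> expectation (\<lambda>\<omega>. (X 0 \<omega>)\<^sup>2 + 1)"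
      using int_i int2 by (intro integral_mono count) auto
    also have "\<dots> = v + 1" using int2 by (simp add: v_def prob_space)
    finally show "(\<Sum>k\<le>n. prob (A k)) \<le> v + 1" .
  qed simp
  then have "AE \<omega> in M. \<forall>\<^sub>F k in sequentially. \<omega> \<in> space M - A k"
    by (intro borel_cantelli_AE1) (auto simp: emeasure_eq_measure)
  then show ?thesis
  proof (rule AE_mp, intro AE_I2 impI)
    fix \<omega> assume \<omega>: "\<omega> \<in> space M" and "\<forall>\<^sub>F k in sequentially. \<omega> \<in> space M - A k"
    then obtain k0 where k0: "\<And>k. k \<ge> k0 \<Longrightarrow> (X k \<omega>)\<^sup>2 \<le> real k"
      unfolding eventually_sequentially by (auto simp: A_def not_less)
    \<comment> \<open>The finitely many exceptional variables are harmless once \<open>n\<close>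
      exceeds the sum of their squares.\<close>
    define S where "S = (\<Sum>k<k0. (X k \<omega>)\<^sup>2)"
    have "\<forall>\<^sub>F n in sequentially. S \<le> real n"
      using filterlim_real_sequentially by (simp add: filterlim_at_top)
    then show "\<forall>\<^sub>F n in sequentially. F n \<omega> = toeplitz_norm n (\<lambda>k. X k \<omega>)"
    proof eventually_elim
      case (elim n)
      show ?case unfolding F_def
      proof (rule toeplitz_norm_cong)
        fix k assume "k < n"
        have "(X k \<omega>)\<^sup>2 \<le> real n"
        proof (cases "k < k0")
          case True
          then have "(X k \<omega>)\<^sup>2 \<le> S" unfolding S_def by (intro member_le_sum) auto
          then show ?thesis using elim by linarith
        next
          case False
          then show ?thesis using k0[of k] \<open>k < n\<close> by simp
        qed
        then show "trunc n (X k \<omega>) = X k \<omega>" by (simp add: trunc_def)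
      qed
    qed
  qed
qed

section \<open>Almost sure convergence of the ratio\<close>

lemma e_at_top: "filterlim e at_top sequentially"
proof -
  obtain c where c: "c > 0" and low: "\<forall>\<^sub>F n in sequentially. c * sqrt (real n * ln (real n)) \<le> e n"
    using e_lower by blast
  have "filterlim (\<lambda>n::nat. sqrt (real n * ln (real n))) at_top sequentially" by real_asymp
  from filterlim_tendsto_pos_mult_at_top[OF tendsto_const c this] low
  show ?thesis by (rule filterlim_at_top_mono)
qed

text \<open>
  Along any sequence \<open>\<nu>\<close> of indices with \<open>e (\<nu> k) \<ge> \<rho> ^ k\<close> the deviation probabilities
  are \<open>O(1 / k\<^sup>2)\<close>, because \<open>e\<close> grows at most linearly.
\<close>

lemma AE_subsequence_deviation:
  assumes \<epsilon>: "\<epsilon> > 0" and \<rho>: "\<rho> > 1" and \<nu>: "\<And>k. \<rho> ^ k \<le> e (\<nu> k)"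
  shows "AE \<omega> in M. \<forall>\<^sub>F k in sequentially. \<bar>toeplitz_norm (\<nu> k) (\<lambda>j. X j \<omega>) - e (\<nu> k)\<bar> < \<epsilon> * e (\<nu> k)"
proof -
  obtain C where C: "\<forall>\<^sub>F n in sequentially. prob {\<omega>\<in>space M. \<bar>F n \<omega> - e n\<bar> \<ge> \<epsilon> * e n} \<le> C / (ln (real n))\<^sup>2"
    using prob_F_deviation[OF \<epsilon>] by blast
  define B where "B = 2 * expectation (\<lambda>\<omega>. \<bar>X 0 \<omega>\<bar>)"
  have lin: "\<rho> ^ k \<le> B * \<nu> k" for k using \<nu>[of k] e_le[of "\<nu> k"] by (simp add: B_def)
  have "B \<ge> 0" by (simp add: B_def)
  moreover have "B \<noteq> 0" using lin[of 0] by auto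
  ultimately have B: "B > 0" by simp
  have \<nu>_ge: "\<rho> ^ k / B \<le> real (\<nu> k)" for k using lin[of k] B by (simp add: divide_le_eq mult.commute)
  have "filterlim (\<lambda>k. \<rho> ^ k / B) at_top sequentially"
    using B \<rho> by real_asymp
  then have "filterlim (\<lambda>k. real (\<nu> k)) at_top sequentially"
    by (rule filterlim_at_top_mono) (use \<nu>_ge in auto)
  then have \<nu>_top: "filterlim \<nu> at_top sequentially"
    by (simp add: filterlim_sequentially_iff_filterlim_real)
  define D where "D k = {\<omega>\<in>space M. \<bar>F (\<nu> k) \<omega> - e (\<nu> k)\<bar> \<ge> \<epsilon> * e (\<nu> k)}" for k
  have D[measurable]: "D k \<in> sets M" for k unfolding D_def by measurable
  \<comment> \<open>The logarithm is k ln \<rho> - ln B; half of the leading term eventually absorbs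
    the constant.\<close>
  have lb: "\<forall>\<^sub>F k in sequentially. ln \<rho> * real k / 2 \<le> ln (\<rho> ^ k / B)"
    using B \<rho> by real_asymp
  have "summable (\<lambda>k. prob (D k))"
  proof (rule summable_comparison_test_ev)
    show "summable (\<lambda>k. \<bar>C\<bar> * (2 / ln \<rho>)\<^sup>2 * inverse (real k ^ 2))"
      by (intro summable_mult inverse_power_summable) simp
    show "\<forall>\<^sub>F k in sequentially. norm (prob (D k)) \<le> \<bar>C\<bar> * (2 / ln \<rho>)\<^sup>2 * inverse (real k ^ 2)"
      using eventually_compose_filterlim[OF C \<nu>_top] lb eventually_gt_at_top[of 0]
    proof eventually_elim
      case (elim k)
      have pos: "ln \<rho> * real k / 2 > 0" using \<rho> elim by simp
      have "\<rho> ^ k / B > 0" using \<rho> B by simp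
      then have "ln (\<rho> ^ k / B) \<le> ln (real (\<nu> k))" using \<nu>_ge[of k] by (intro ln_mono) auto
      then have le: "(ln \<rho> * real k / 2)\<^sup>2 \<le> (ln (real (\<nu> k)))\<^sup>2"
        using elim(2) pos by (intro power_mono) auto
      have sp: "0 < (ln \<rho> * real k / 2)\<^sup>2" using pos by (rule zero_less_power)
      have "prob (D k) \<le> C / (ln (real (\<nu> k)))\<^sup>2" using elim by (simp add: D_def)
      also have "\<dots> \<le> \<bar>C\<bar> / (ln (real (\<nu> k)))\<^sup>2" by (intro divide_right_mono) auto
      also have "\<dots> \<le> \<bar>C\<bar> / (ln \<rho> * real k / 2)\<^sup>2"
        using le less_le_trans[OF sp le] sp by (intro divide_left_mono mult_pos_pos) auto
      also have "\<dots> = \<bar>C\<bar> * (2 / ln \<rho>)\<^sup>2 * inverse (real k ^ 2)"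
        using elim \<rho> by (simp add: power_divide power_mult_distrib field_simps)
      finally show ?case by simp
    qed
  qed
  then have "AE \<omega> in M. \<forall>\<^sub>F k in sequentially. \<omega> \<in> space M - D k"
    by (intro borel_cantelli_AE1) (auto simp: emeasure_eq_measure)
  with AE_eventually_F_eq show ?thesis
  proof eventually_elim
    case (elim \<omega>)
    from eventually_compose_filterlim[OF elim(1) \<nu>_top] elim(2) show ?case
      by eventually_elim (auto simp: D_def)
  qed
qed

text \<open>
  The subsequence is chosen from \<open>e\<close> itself: \<open>e\<close> varies at most by the factor \<open>\<rho>\<close> between
  \<open>n k\<close> and \<open>n (k + 1) - 1\<close>, where \<open>n k\<close> is the first index at which \<open>e\<close> reaches \<open>\<rho> ^ k\<close>. Monotonicity of the
  norm then interpolates without any regularity of \<open>e\<close>.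
\<close>

lemma AE_ratio_close:
  assumes \<epsilon>: "0 < \<epsilon>" "\<epsilon> < 1"
  shows "AE \<omega> in M. \<forall>\<^sub>F n in sequentially. (1 - \<epsilon>) / (1 + \<epsilon>) \<le> toeplitz_norm n (\<lambda>j. X j \<omega>) / e n \<and>
     toeplitz_norm n (\<lambda>j. X j \<omega>) / e n \<le> (1 + \<epsilon>)\<^sup>2"
proof -
  define \<rho> where "\<rho> = 1 + \<epsilon>"
  have \<rho>: "\<rho> > 1" using \<epsilon> by (simp add: \<rho>_def)
  have ex: "\<exists>n. \<rho> ^ k \<le> e n" for k
    using e_at_top unfolding filterlim_at_top eventually_sequentially by blast
  define a where "a k = (LEAST n. \<rho> ^ k \<le> e n)" for k
  have a: "\<rho> ^ k \<le> e (a k)" for k unfolding a_def using ex by (rule LeastI_ex)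
  have a_less: "e n < \<rho> ^ k" if "n < a k" for n k
    using not_less_Least[of n "\<lambda>n. \<rho> ^ k \<le> e n"] that by (auto simp: a_def)
  have a_le: "a k \<le> n" if "\<rho> ^ k \<le> e n" for n k unfolding a_def using that by (rule Least_le)
  \<comment> \<open>\<open>b k\<close> is the last index before the next crossing. If
    \<open>e\<close> jumps over a whole level, \<open>a (Suc k) = a k\<close>, and the maximum keeps
    \<open>\<rho> ^ k \<le> e (b k)\<close>.\<close>
  define b where "b k = max (a k) (a (Suc k) - 1)" for k
  have b: "\<rho> ^ k \<le> e (b k)" for k using a[of k] e_mono[of "a k" "b k"] by (simp add: b_def)
  from AE_subsequence_deviation[OF \<epsilon>(1) \<rho> a] AE_subsequence_deviation[OF \<epsilon>(1) \<rho> b]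
  show ?thesis
  proof eventually_elim
    case (elim \<omega>)
    define f where "f n = toeplitz_norm n (\<lambda>j. X j \<omega>)" for n
    from elim obtain k0 where
      k0: "\<And>k. k \<ge> k0 \<Longrightarrow> \<bar>f (a k) - e (a k)\<bar> < \<epsilon> * e (a k) \<and> \<bar>f (b k) - e (b k)\<bar> < \<epsilon> * e (b k)"
      unfolding f_def using eventually_conj[OF elim] by (auto simp: eventually_sequentially)
    have "\<forall>\<^sub>F n in sequentially. \<rho> ^ k0 \<le> e n"
      using e_at_top by (simp add: filterlim_at_top)
    then have "\<forall>\<^sub>F n in sequentially. (1 - \<epsilon>) / (1 + \<epsilon>) \<le> f n / e n \<and> f n / e n \<le> (1 + \<epsilon>)\<^sup>2"
    proof eventually_elim
      case (elim n)
      have en: "e n > 0" using less_le_trans[OF zero_less_power elim] \<rho> by simp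
      obtain m where "e n < \<rho> ^ m" using real_arch_pow[OF \<rho>] by blast
      then have finK: "k \<le> m" if "\<rho> ^ k \<le> e n" for k
        using that power_less_imp_less_exp[OF \<rho>, of k m] by linarith
      define k where "k = (GREATEST k. \<rho> ^ k \<le> e n)"
      have k: "\<rho> ^ k \<le> e n" unfolding k_def using elim finK by (rule GreatestI_nat)
      have kk0: "k0 \<le> k" unfolding k_def using elim finK by (rule Greatest_le_nat)
      have k1: "e n < \<rho> ^ Suc k"
      proof (rule ccontr)
        assume "\<not> e n < \<rho> ^ Suc k"
        then have "Suc k \<le> k" unfolding k_def using finK by (intro Greatest_le_nat) (auto simp: k_def)
        then show False by simp
      qed
      have "a k \<le> n" using k by (rule a_le)
      have "n < a (Suc k)" using k1 a[of "Suc k"] e_mono[of "a (Suc k)" n] by linarith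
      then have "n \<le> a (Suc k) - 1" "a (Suc k) - 1 < a (Suc k)" by auto
      then have bk: "b k = a (Suc k) - 1" using \<open>a k \<le> n\<close> by (simp add: b_def)
      have eb: "e (b k) < \<rho> ^ Suc k" unfolding bk using \<open>a (Suc k) - 1 < a (Suc k)\<close> by (rule a_less)
      \<comment> \<open>The lower estimate loses one factor \<rho> through the variation of
        \<open>e\<close>. The upper one loses the same factor and another from concentration, since
        1 + \<epsilon> = \<rho>; hence the asymmetric bounds.\<close>
      have "(1 - \<epsilon>) * e n \<le> (1 - \<epsilon>) * (\<rho> * \<rho> ^ k)" using k1 \<epsilon> by (intro mult_left_mono) auto
      also have "\<dots> \<le> \<rho> * ((1 - \<epsilon>) * e (a k))" using a[of k] \<epsilon> \<rho> by (simp add: mult_left_mono)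
      also have "(1 - \<epsilon>) * e (a k) \<le> f (a k)" using k0[OF kk0] by (auto simp: algebra_simps abs_less_iff)
      also have "f (a k) \<le> f n" unfolding f_def using \<open>a k \<le> n\<close> by (rule toeplitz_norm_mono)
      finally have low: "(1 - \<epsilon>) * e n \<le> \<rho> * f n" using \<rho> by simp
      have "f n \<le> f (b k)" unfolding f_def bk using \<open>n \<le> a (Suc k) - 1\<close> by (rule toeplitz_norm_mono)
      also have "\<dots> \<le> \<rho> * e (b k)" using k0[OF kk0] by (auto simp: \<rho>_def algebra_simps abs_less_iff)
      also have "\<dots> \<le> \<rho> * (\<rho> * e n)" using eb k \<rho> by (intro mult_left_mono) (auto intro: order_trans[OF less_imp_le])
      finally have "f n \<le> \<rho>\<^sup>2 * e n" by (simp add: power2_eq_square)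
      then show ?case using low en \<epsilon> by (simp add: \<rho>_def field_simps)
    qed
    then show ?case by (simp add: f_def)
  qed
qed

text \<open>Restricting \<epsilon> to the countable family 1 / (i + 2) gives one null set for all
  tolerances; the shift by 2 keeps \<epsilon> < 1 at \<open>i = 0\<close>.\<close>

lemma AE_ratio_tendsto: "AE \<omega> in M. (\<lambda>n. toeplitz_norm n (\<lambda>k. X k \<omega>) / e n) \<longlonglongrightarrow> 1"
proof -
  have "AE \<omega> in M. \<forall>i::nat. \<forall>\<^sub>F n in sequentially.
     (1 - 1 / (real i + 2)) / (1 + 1 / (real i + 2)) \<le> toeplitz_norm n (\<lambda>j. X j \<omega>) / e n \<and>
     toeplitz_norm n (\<lambda>j. X j \<omega>) / e n \<le> (1 + 1 / (real i + 2))\<^sup>2"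
    unfolding AE_all_countable by (intro allI AE_ratio_close) auto
  then show ?thesis
  proof (rule AE_mp, intro AE_I2 impI)
    fix \<omega>
    define q where "q n = toeplitz_norm n (\<lambda>j. X j \<omega>) / e n" for n
    assume "\<forall>i::nat. \<forall>\<^sub>F n in sequentially.
     (1 - 1 / (real i + 2)) / (1 + 1 / (real i + 2)) \<le> toeplitz_norm n (\<lambda>j. X j \<omega>) / e n \<and>
     toeplitz_norm n (\<lambda>j. X j \<omega>) / e n \<le> (1 + 1 / (real i + 2))\<^sup>2"
    then have q: "\<forall>\<^sub>F n in sequentially. (1 - 1 / (real i + 2)) / (1 + 1 / (real i + 2)) \<le> q n"
      "\<forall>\<^sub>F n in sequentially. q n \<le> (1 + 1 / (real i + 2))\<^sup>2" for i
      unfolding q_def by (auto elim: eventually_mono)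
    have lim: "(\<lambda>i::nat. (1 - 1 / (real i + 2)) / (1 + 1 / (real i + 2))) \<longlonglongrightarrow> 1"
      "(\<lambda>i::nat. (1 + 1 / (real i + 2))\<^sup>2) \<longlonglongrightarrow> 1" by real_asymp+
    have "q \<longlonglongrightarrow> 1"
    proof (rule order_tendstoI)
      fix y :: real assume "y < 1"
      from order_tendstoD(1)[OF lim(1) this] obtain i where "y < (1 - 1 / (real i + 2)) / (1 + 1 / (real i + 2))"
        by (auto dest: eventually_happens)
      with q(1)[of i] show "\<forall>\<^sub>F n in sequentially. y < q n" by (auto elim: eventually_mono)
    next
      fix y :: real assume "1 < y"
      from order_tendstoD(2)[OF lim(2) this] obtain i where "(1 + 1 / (real i + 2))\<^sup>2 < y"
        by (auto dest: eventually_happens)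
      with q(2)[of i] show "\<forall>\<^sub>F n in sequentially. q n < y" by (auto elim: eventually_mono)
    qed
    then show "(\<lambda>n. toeplitz_norm n (\<lambda>k. X k \<omega>) / e n) \<longlonglongrightarrow> 1" by (simp add: q_def[abs_def])
  qed
qed

end

theorem mainTheorem6:
  fixes M :: "'a measure" and X :: "nat \<Rightarrow> 'a \<Rightarrow> real"
  assumes "prob_space M"
    and meas: "\<And>k. X k \<in> borel_measurable M"
    and indep: "prob_space.indep_vars M (\<lambda>_. borel) X UNIV"
    and ident: "\<And>k. distr M borel (X k) = distr M borel (X 0)"
    and int2: "integrable M (\<lambda>\<omega>. (X 0 \<omega>)\<^sup>2)"
    and mean0: "prob_space.expectation M (X 0) = 0"
    and var_pos: "prob_space.expectation M (\<lambda>\<omega>. (X 0 \<omega>)\<^sup>2) > 0"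
  shows "AE \<omega> in M. (\<lambda>n. toeplitz_norm n (\<lambda>k. X k \<omega>) /
            prob_space.expectation M (\<lambda>\<omega>'. toeplitz_norm n (\<lambda>k. X k \<omega>')))
          \<longlonglongrightarrow> 1"
proof -
  interpret iid_L2 M X
    using assms by (intro iid_L2.intro iid_L2_axioms.intro)
  show ?thesis using AE_ratio_tendsto unfolding e_def .
qed

end
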